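(* For every $n\ge1$ the associahedra satisfy $$\gamma(As^n)=\gamma(As^{n-1})+\tau\sum_{i=1}^{n-1}\gamma(As^{i-1})\,\gamma(As^{n-i-1}),$$ $$H(As^n)=(\alpha+t)H(As^{n-1})+\alpha t\sum_{i=1}^{n-1}H(As^{i-1})\,H(As^{n-i-1}).$$
   Context: Notation: $[m]=\{1,\ldots,m\}$. For a simple graph $\Gamma$ on $[n+1]$, $B(\Gamma)$ is the collection of nonempty $S\subseteq[n+1]$ such that the induced subgraph $\Gamma|_S$ is connected. The graph-associahedron is the Minkowski sum $P_\Gamma=\sum_{S\in B(\Gamma)}\mathrm{conv}\{e_i : i\in S\}\subset\mathbb{R}^{n+1}$, with $e_i$ the standard basis vectors; for connected $\Gamma$ it is a simple polytope of dimension $n$. The associahedron is $As^n=P_{L_{n+1}}$, where $L_{n+1}$ is the path graph on $[n+1]$ ($As^0$ is a point). For a $d$-dimensional simple polytope $P$, let $f_i$ be the number of its $i$-dimensional faces ($f_d=1$), $F(P)(\alpha,t)=\sum_{i=0}^d f_i\alpha^i t^{d-i}$ and $H(P)(\alpha,t)=F(P)(\alpha-t,t)$. By the Dehn–Sommerville equations $H(P)$ is symmetric, so it is uniquely written as $H(P)=\sum_{i=0}^{\lfloor d/2\rfloor}\gamma_i(\alpha t)^i(\alpha+t)^{d-2i}$; the $\gamma$-polynomial is $\gamma(P)(\tau)=\sum_{i=0}^{\lfloor d/2\rfloor}\gamma_i\tau^i$. For a point, $H=\gamma=1$. Empty sums are $0$. *)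

theory Defs
  imports
    "HOL-Analysis.Analysis"
    "HOL-Library.Function_Algebras"
    "HOL-Computational_Algebra.Polynomial"
begin

text \<open>
  The spaces R^1, R^2, ... occur together in one formula, so R^m is modelled as the subspace
  of functions \<^typ>\<open>nat \<Rightarrow> real\<close> that vanish outside {1..m}, with pointwise operations.
\<close>

instantiation "fun" :: (type, real_vector) real_vector
begin

definition scaleR_fun :: "real \<Rightarrow> ('a \<Rightarrow> 'b) \<Rightarrow> 'a \<Rightarrow> 'b" where
  "scaleR_fun c f = (\<lambda>x. c *\<^sub>R f x)"

instance
  by standard (simp_all add: scaleR_fun_def fun_eq_iff scaleR_add_right scaleR_add_left)

end

definition std_basis :: "nat \<Rightarrow> nat \<Rightarrow> real" where
  "std_basis i = (\<lambda>j. if j = i then 1 else 0)"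


text \<open>
  A simple graph on {1..m} is given by its set E of edges, which are two-element subsets
  of {1..m}.
\<close>

definition induced_connected :: "nat set set \<Rightarrow> nat set \<Rightarrow> bool" where
  "induced_connected E S \<longleftrightarrow>
     S \<noteq> {} \<and> (\<forall>u\<in>S. \<forall>v\<in>S. (u, v) \<in> {(x, y). x \<in> S \<and> y \<in> S \<and> {x, y} \<in> E}\<^sup>*)"

definition building_set :: "nat \<Rightarrow> nat set set \<Rightarrow> nat set set" where
  "building_set m E = {S. S \<subseteq> {1..m} \<and> induced_connected E S}"

text \<open>The addition of sets below is the elementwise one, so the sum is a Minkowski sum.\<close>

definition graph_associahedron :: "nat \<Rightarrow> nat set set \<Rightarrow> (nat \<Rightarrow> real) set" where
  "graph_associahedron m E = (\<Sum>S\<in>building_set m E. convex hull (std_basis ` S))"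

definition path_graph :: "nat \<Rightarrow> nat set set" where
  "path_graph m = {{i, Suc i} | i. 1 \<le> i \<and> i < m}"

definition associahedron :: "nat \<Rightarrow> (nat \<Rightarrow> real) set" where
  "associahedron n = graph_associahedron (n + 1) (path_graph (n + 1))"


text \<open>
  The library's \<^term>\<open>aff_dim\<close> is restricted to Euclidean spaces. The following is the dimension
  of the linear space parallel to the affine hull; it is meant for nonempty sets that span
  a finite-dimensional space.
\<close>

definition affdim :: "'a::real_vector set \<Rightarrow> nat" where
  "affdim S = dim {x - y | x y. x \<in> S \<and> y \<in> S}"

definition num_faces :: "'a::real_vector set \<Rightarrow> nat \<Rightarrow> nat" where
  "num_faces P i = card {F. F face_of P \<and> F \<noteq> {} \<and> affdim F = i}"

text \<open>
  The polynomials F(P) and H(P) are written as expressions in two elements of a commutative ring,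
  so that the substitution of \<open>a - t\<close> for \<open>a\<close> is literal; they become polynomials on inserting
  the two indeterminates of \<^typ>\<open>int poly poly\<close>.
\<close>

definition F_expr :: "'v::real_vector set \<Rightarrow> 'a::comm_ring_1 \<Rightarrow> 'a \<Rightarrow> 'a" where
  "F_expr P a t = (\<Sum>i\<le>affdim P. of_nat (num_faces P i) * a ^ i * t ^ (affdim P - i))"

definition H_expr :: "'v::real_vector set \<Rightarrow> 'a::comm_ring_1 \<Rightarrow> 'a \<Rightarrow> 'a" where
  "H_expr P a t = F_expr P (a - t) t"

definition var_alpha :: "int poly poly" where
  "var_alpha = [:0, 1:]"

definition var_t :: "int poly poly" where
  "var_t = [:[:0, 1:]:]"

definition H_poly :: "'v::real_vector set \<Rightarrow> int poly poly" where
  "H_poly P = H_expr P var_alpha var_t"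

definition gamma_poly :: "'v::real_vector set \<Rightarrow> int poly" where
  "gamma_poly P = (THE g. degree g \<le> affdim P div 2 \<and>
     H_poly P = (\<Sum>i\<le>affdim P div 2. of_int (coeff g i) * (var_alpha * var_t) ^ i *
                                       (var_alpha + var_t) ^ (affdim P - 2 * i)))"

end

theory Submission
  imports Defs
begin

text \<open>
  Both recursions come from counting the faces of the associahedron as tubings: nested families
  \<open>N\<close> of intervals of the path, containing the whole path, in which two incomparable intervals are
  never close enough to form an interval together.

  \<^emph>\<open>Faces are tubings.\<close> A point \<open>x\<close> of the Minkowski sum is a sum of points of the simplices of
  the connected sets \<open>S\<close>. The sum of the coordinates of \<open>x\<close> over a connected set \<open>I\<close> is at least
  the number of connected sets inside \<open>I\<close>; call \<open>I\<close> tight for \<open>x\<close> in case of equality. An exchange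
  argument (\<open>feasible_if_tight_subset\<close>) shows that if all sets tight for \<open>x\<close> are tight for \<open>y\<close>,
  then one can move from \<open>x\<close> a little away from \<open>y\<close>. Hence every face is cut out by its tight sets
  (\<open>face_eq_tube_face\<close>). The families of tight sets are exactly the tubings
  (\<open>tight_in_tubings\<close>, \<open>tubing_is_tight\<close>), and the face of \<open>N\<close> has dimension \<open>|V| - |N|\<close>
  (\<open>affdim_tube_face\<close>), because the tubes cut \<open>V\<close> into \<open>|N|\<close> blocks over each of which the
  coordinate sum is fixed. This part works for any connected graph.

  \<^emph>\<open>Counting.\<close> On a path, cut a tubing at the least vertex \<open>r\<close> that lies in no proper tube. If
  there is anything to the left of \<open>r\<close>, it is a tube with a tubing of its own; to the right of \<open>r\<close>
  there is a tubing from which the top tube may or may not be removed. With weights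
  \<open>\<alpha>\<close> per dimension and \<open>t\<close> per codimension, a nonempty left side contributes a factor \<open>t\<close> and a
  nonempty right side a factor \<open>\<alpha> + t\<close>. This gives
  \<open>F\<^sub>n = (\<alpha> + 2t) F\<^sub>n\<^sub>-\<^sub>1 + (\<alpha> + t) t (\<Sum> F\<^sub>i\<^sub>-\<^sub>1 F\<^sub>n\<^sub>-\<^sub>i\<^sub>-\<^sub>1)\<close>
  (\<open>tubing_sum_recursion\<close>), and replacing \<open>\<alpha>\<close> by \<open>\<alpha> - t\<close> turns it into the recursion for \<open>H\<close>.

  \<^emph>\<open>Gamma polynomials.\<close> The expansion of \<open>H\<close> in \<open>\<alpha> t\<close> and \<open>\<alpha> + t\<close> is injective in its coefficients
  (\<open>gamma_expand_inject\<close>) and multiplicative (\<open>gamma_expand_mult\<close>), and \<open>\<tau>\<close> of degree two expands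
  to \<open>\<alpha> t\<close>. So the polynomials given by the recursion for \<open>\<gamma>\<close> expand to \<open>H\<close>, and by induction
  this proves the existence of the expansion along with the recursion.
\<close>

section \<open>Minkowski sums of simplices\<close>

definition std_simplex :: "nat set \<Rightarrow> (nat \<Rightarrow> real) set" where
  "std_simplex S = {x. (\<forall>i. 0 \<le> x i) \<and> (\<forall>i. i \<notin> S \<longrightarrow> x i = 0) \<and> sum x S = 1}"

lemma sum_fun_apply: "(\<Sum>i\<in>A. f i) x = (\<Sum>i\<in>A. f i x)"
  by (induction A rule: infinite_finite_induct) auto

lemma std_simplexD:
  assumes "x \<in> std_simplex S"
  shows "0 \<le> x i" "i \<notin> S \<Longrightarrow> x i = 0" "sum x S = 1"
  using assms by (auto simp: std_simplex_def)

lemma std_simplex_sum_eq_1: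
  assumes "x \<in> std_simplex S" "S \<subseteq> R" "finite R"
  shows "sum x R = 1"
  using sum.mono_neutral_left[of R S x] assms std_simplexD[OF assms(1)] by auto

lemma std_basis_in_std_simplex:
  assumes "i \<in> S" "finite S"
  shows "std_basis i \<in> std_simplex S"
  using assms by (auto simp: std_simplex_def std_basis_def)

lemma convex_std_simplex: "convex (std_simplex S)"
  unfolding convex_def std_simplex_def
  by (auto simp: scaleR_fun_def sum.distrib sum_distrib_left[symmetric])

lemma std_simplex_expand:
  assumes "finite S" "\<And>i. i \<notin> S \<Longrightarrow> x i = 0"
  shows "x = (\<Sum>i\<in>S. x i *\<^sub>R std_basis i)"
  by (rule ext) (use assms in \<open>auto simp: sum_fun_apply scaleR_fun_def std_basis_def if_distrib cong: if_cong\<close>)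

lemma convex_hull_std_basis:
  assumes "finite S"
  shows "convex hull (std_basis ` S) = std_simplex S"
proof
  show "convex hull (std_basis ` S) \<subseteq> std_simplex S"
    by (rule hull_minimal) (auto simp: convex_std_simplex std_basis_in_std_simplex assms)
  show "std_simplex S \<subseteq> convex hull (std_basis ` S)"
  proof
    fix x assume x: "x \<in> std_simplex S"
    have "(\<Sum>i\<in>S. x i *\<^sub>R std_basis i) \<in> convex hull (std_basis ` S)"
      by (rule convex_sum) (use x assms in \<open>auto simp: std_simplex_def hull_inc\<close>)
    then show "x \<in> convex hull (std_basis ` S)"
      using std_simplex_expand[OF assms, of x] std_simplexD(2)[OF x] by simp
  qed
qed

definition nested :: "nat set set \<Rightarrow> nat set set \<Rightarrow> bool" where
  "nested B N \<longleftrightarrow> N \<subseteq> B \<and> (\<forall>I\<in>N. \<forall>J\<in>N. I \<subseteq> J \<or> J \<subseteq> I \<or> I \<union> J \<notin> B)"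

definition tubings :: "nat set \<Rightarrow> nat set set \<Rightarrow> nat set set set" where
  "tubings V B = {N. nested B N \<and> V \<in> N}"

text \<open>
  Everything about faces uses the graph only through the family of its connected vertex sets.
  The last axiom is where it matters that the family comes from a graph: a connected set covered
  by tubes that are pairwise nested or far apart lies inside a single one of them.
\<close>

locale graphical_family =
  fixes V :: "nat set" and B :: "nat set set"
  assumes finite_V: "finite V"
    and V_in: "V \<in> B"
    and B_subset: "S \<in> B \<Longrightarrow> S \<subseteq> V"
    and B_nonempty: "S \<in> B \<Longrightarrow> S \<noteq> {}"
    and singleton_in: "i \<in> V \<Longrightarrow> {i} \<in> B"
    and union_in: "I \<in> B \<Longrightarrow> J \<in> B \<Longrightarrow> I \<inter> J \<noteq> {} \<Longrightarrow> I \<union> J \<in> B"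
    and covered: "S \<in> B \<Longrightarrow> C \<subseteq> B \<Longrightarrow> (\<And>I J. I \<in> C \<Longrightarrow> J \<in> C \<Longrightarrow> I \<subseteq> J \<or> J \<subseteq> I \<or> I \<union> J \<notin> B)
      \<Longrightarrow> S \<subseteq> \<Union>C \<Longrightarrow> \<exists>I\<in>C. S \<subseteq> I"
begin

lemma finite_B: "finite B"
  using finite_V B_subset by (meson Pow_iff finite_Pow_iff finite_subset subsetI)

lemma finite_member: "S \<in> B \<Longrightarrow> finite S"
  using finite_V B_subset finite_subset by blast

definition polytope :: "(nat \<Rightarrow> real) set" where
  "polytope = (\<Sum>S\<in>B. std_simplex S)"

definition decomp :: "(nat set \<Rightarrow> nat \<Rightarrow> real) \<Rightarrow> (nat \<Rightarrow> real) \<Rightarrow> bool" where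
  "decomp s x \<longleftrightarrow> (\<forall>S\<in>B. s S \<in> std_simplex S) \<and> x = (\<Sum>S\<in>B. s S)"

lemma polytope_iff: "x \<in> polytope \<longleftrightarrow> (\<exists>s. decomp s x)"
  unfolding polytope_def set_sum_alt[OF finite_B] decomp_def by auto

lemma convex_polytope: "convex polytope"
  unfolding polytope_def by (intro convex_set_sum convex_std_simplex)

lemma decompD:
  assumes "decomp s x"
  shows "S \<in> B \<Longrightarrow> s S \<in> std_simplex S" "x i = (\<Sum>S\<in>B. s S i)"
  using assms by (auto simp: decomp_def sum_fun_apply)

lemma polytope_outside:
  assumes "x \<in> polytope" "i \<notin> V"
  shows "x i = 0"
proof -
  obtain s where s: "decomp s x" using assms by (auto simp: polytope_iff)
  have "s S i = 0" if "S \<in> B" for S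
    using std_simplexD(2)[OF decompD(1)[OF s that]] B_subset[OF that] assms(2) by blast
  then show ?thesis using decompD(2)[OF s, of i] by simp
qed

lemma sum_decomp:
  assumes "decomp s x"
  shows "sum x R = (\<Sum>S\<in>B. sum (s S) R)"
  using decompD(2)[OF assms] by (simp add: sum.swap[of _ B])

section \<open>Tight sets\<close>

definition min_load :: "nat set \<Rightarrow> nat" where
  "min_load R = card {S \<in> B. S \<subseteq> R}"

definition tight :: "(nat \<Rightarrow> real) \<Rightarrow> nat set set" where
  "tight x = {I \<in> B. sum x I = real (min_load I)}"

lemma min_load_eq: "real (min_load R) = (\<Sum>S\<in>B. if S \<subseteq> R then 1 else 0)"
  using finite_B by (simp add: min_load_def sum.If_cases Int_def)

lemma min_load_le_component:
  assumes "decomp s x" "S \<in> B" "R \<subseteq> V"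
  shows "(if S \<subseteq> R then 1 else 0) \<le> sum (s S) R"
proof -
  have "finite R" using assms(3) finite_V finite_subset by auto
  then show ?thesis
    using decompD(1)[OF assms(1,2)] std_simplex_sum_eq_1[of "s S" S R]
    by (auto intro!: sum_nonneg dest: std_simplexD(1))
qed

lemma min_load_le:
  assumes "x \<in> polytope" "R \<subseteq> V"
  shows "real (min_load R) \<le> sum x R"
  using assms sum_decomp min_load_le_component
  by (auto simp: polytope_iff min_load_eq intro!: sum_mono)

text \<open>
  Each simplex of a set inside \<open>R\<close> puts its whole mass on \<open>R\<close>, so the load of \<open>R\<close> is minimal
  exactly when no other simplex contributes to it. This holds for every decomposition of the point.
\<close>

lemma tight_iff_vanish:
  assumes "decomp s x" "R \<subseteq> V"
  shows "sum x R = real (min_load R) \<longleftrightarrow> (\<forall>S\<in>B. \<not> S \<subseteq> R \<longrightarrow> (\<forall>i\<in>R. s S i = 0))"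
proof -
  have fR: "finite R" using assms(2) finite_V finite_subset by auto
  let ?f = "\<lambda>S. if S \<subseteq> R then 1 else 0 :: real"
  have le: "?f S \<le> sum (s S) R" if "S \<in> B" for S
    using min_load_le_component[OF assms(1) that assms(2)] .
  have "sum x R = real (min_load R) \<longleftrightarrow> (\<Sum>S\<in>B. sum (s S) R - ?f S) = 0"
    by (simp add: sum_decomp[OF assms(1)] min_load_eq sum_subtractf)
  also have "\<dots> \<longleftrightarrow> (\<forall>S\<in>B. sum (s S) R - ?f S = 0)"
    by (rule sum_nonneg_eq_0_iff) (use finite_B le in auto)
  also have "\<dots> \<longleftrightarrow> (\<forall>S\<in>B. \<not> S \<subseteq> R \<longrightarrow> (\<forall>i\<in>R. s S i = 0))"
  proof (intro ball_cong refl)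
    fix S assume "S \<in> B"
    then have s: "s S \<in> std_simplex S" using decompD(1)[OF assms(1)] by auto
    show "(sum (s S) R - ?f S = 0) = (\<not> S \<subseteq> R \<longrightarrow> (\<forall>i\<in>R. s S i = 0))"
      using std_simplex_sum_eq_1[OF s _ fR] std_simplexD(1)[OF s]
      by (auto simp: sum_nonneg_eq_0_iff[OF fR])
  qed
  finally show ?thesis .
qed

lemma tightD:
  assumes "decomp s x" "I \<in> tight x" "S \<in> B" "i \<in> I" "i \<in> S" "s S i \<noteq> 0"
  shows "S \<subseteq> I"
  using assms tight_iff_vanish[OF assms(1), of I] B_subset by (auto simp: tight_def)

lemma tightI:
  assumes "decomp s x" "I \<in> B" "\<And>S i. S \<in> B \<Longrightarrow> \<not> S \<subseteq> I \<Longrightarrow> i \<in> I \<Longrightarrow> s S i = 0"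
  shows "I \<in> tight x"
  using assms tight_iff_vanish[OF assms(1), of I] B_subset by (auto simp: tight_def)

text \<open>
  If \<open>I\<close> and \<open>J\<close> are tight and neither contains the other, then the simplex of \<open>I \<union> J\<close> has no
  mass on \<open>I\<close> and none on \<open>J\<close>; so there is no such simplex.
\<close>

lemma tight_in_tubings:
  assumes "x \<in> polytope"
  shows "tight x \<in> tubings V B"
proof -
  obtain s where s: "decomp s x" using assms by (auto simp: polytope_iff)
  have "I \<subseteq> J \<or> J \<subseteq> I \<or> I \<union> J \<notin> B" if I: "I \<in> tight x" and J: "J \<in> tight x" for I J
  proof (rule ccontr)
    assume "\<not> ?thesis"
    then have n: "\<not> I \<subseteq> J" "\<not> J \<subseteq> I" and S: "I \<union> J \<in> B" by auto
    have "s (I \<union> J) i = 0" if "i \<in> I \<union> J" for i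
      using tightD[OF s I S, of i] tightD[OF s J S, of i] that n by auto
    then have "sum (s (I \<union> J)) (I \<union> J) = 0" by simp
    then show False using std_simplexD(3)[OF decompD(1)[OF s S]] by simp
  qed
  moreover have "V \<in> tight x"
    using tightI[OF s V_in] B_subset by blast
  ultimately show ?thesis by (auto simp: tubings_def nested_def tight_def)
qed

section \<open>Feasible directions\<close>

definition feasible :: "(nat \<Rightarrow> real) \<Rightarrow> (nat \<Rightarrow> real) set" where
  "feasible x = {d. \<exists>e>0. x + e *\<^sub>R d \<in> polytope}"

lemma polytope_step_shrink:
  assumes "x \<in> polytope" "x + e *\<^sub>R d \<in> polytope" "0 \<le> e'" "e' \<le> e"
  shows "x + e' *\<^sub>R d \<in> polytope"
proof (cases "e = 0")
  case False
  then have e: "e > 0" using assms by auto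
  have "(1 - e'/e) *\<^sub>R x + (e'/e) *\<^sub>R (x + e *\<^sub>R d) \<in> polytope"
    using assms e by (intro convexD[OF convex_polytope]) auto
  moreover have "(1 - e'/e) *\<^sub>R x + (e'/e) *\<^sub>R (x + e *\<^sub>R d) = x + e' *\<^sub>R d"
    using e by (simp add: algebra_simps)
  ultimately show ?thesis by simp
qed (use assms in auto)

lemma feasible_0: "x \<in> polytope \<Longrightarrow> 0 \<in> feasible x"
  by (auto simp: feasible_def intro!: exI[of _ 1])

lemma feasible_scale:
  assumes "x \<in> polytope" "d \<in> feasible x" "0 \<le> c"
  shows "c *\<^sub>R d \<in> feasible x"
proof (cases "c = 0")
  case False
  then have c: "c > 0" using assms by auto
  obtain e where "e > 0" "x + e *\<^sub>R d \<in> polytope" using assms by (auto simp: feasible_def)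
  then show ?thesis using c by (auto simp: feasible_def intro!: exI[of _ "e / c"])
qed (use feasible_0 assms in auto)

lemma feasible_add:
  assumes "x \<in> polytope" "d \<in> feasible x" "d' \<in> feasible x"
  shows "d + d' \<in> feasible x"
proof -
  obtain e e' where e: "e > 0" "x + e *\<^sub>R d \<in> polytope" "e' > 0" "x + e' *\<^sub>R d' \<in> polytope"
    using assms by (auto simp: feasible_def)
  define m where "m = min e e'"
  have m: "m > 0" "x + m *\<^sub>R d \<in> polytope" "x + m *\<^sub>R d' \<in> polytope"
    using e polytope_step_shrink[OF assms(1), of e d m] polytope_step_shrink[OF assms(1), of e' d' m]
    by (auto simp: m_def)
  have "(1/2) *\<^sub>R (x + m *\<^sub>R d) + (1/2) *\<^sub>R (x + m *\<^sub>R d') \<in> polytope"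
    using m by (intro convexD[OF convex_polytope]) auto
  moreover have "(1/2) *\<^sub>R (x + m *\<^sub>R d) + (1/2) *\<^sub>R (x + m *\<^sub>R d') = x + (m/2) *\<^sub>R (d + d')"
    by (rule ext) (simp add: scaleR_fun_def field_simps)
  ultimately show ?thesis using m by (auto simp: feasible_def intro!: exI[of _ "m/2"])
qed

lemma feasible_sum:
  assumes "x \<in> polytope" "\<And>i. i \<in> A \<Longrightarrow> d i \<in> feasible x"
  shows "(\<Sum>i\<in>A. d i) \<in> feasible x"
  using assms(2)
  by (induction A rule: infinite_finite_induct) (auto simp: feasible_0 feasible_add assms(1))

text \<open>A simplex that puts mass on \<open>i\<close> can move some of it to any other vertex.\<close>

lemma feasible_exchange:
  assumes "decomp s x" "S \<in> B" "i \<in> S" "j \<in> S" "s S i > 0"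
  shows "std_basis j - std_basis i \<in> feasible x"
proof -
  define e where "e = s S i"
  define v where "v = s S + e *\<^sub>R (std_basis j - std_basis i)"
  have S: "s S \<in> std_simplex S" using decompD(1)[OF assms(1,2)] .
  have fS: "finite S" using finite_member assms by auto
  have "sum (std_basis j - std_basis i) S = (0::real)"
    using assms(3,4) fS by (simp add: std_basis_def sum_subtractf)
  then have "sum v S = 1"
    using std_simplexD(3)[OF S]
    by (simp add: v_def scaleR_fun_def sum.distrib sum_distrib_left[symmetric])
  moreover have "0 \<le> v k" for k
    using std_simplexD(1)[OF S, of k] assms(5) by (auto simp: v_def e_def scaleR_fun_def std_basis_def)
  moreover have "v k = 0" if "k \<notin> S" for k
    using std_simplexD(2)[OF S that] that assms(3,4)
    by (auto simp: v_def scaleR_fun_def std_basis_def)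
  ultimately have v: "v \<in> std_simplex S" by (auto simp: std_simplex_def)
  have "decomp (s(S := v)) (x + e *\<^sub>R (std_basis j - std_basis i))"
  proof -
    have "(\<Sum>T\<in>B. (s(S := v)) T) = v + (\<Sum>T\<in>B - {S}. s T)"
      using finite_B assms(2) by (subst sum.remove[of _ S]) (auto intro!: sum.cong)
    also have "\<dots> = e *\<^sub>R (std_basis j - std_basis i) + (s S + (\<Sum>T\<in>B - {S}. s T))"
      by (simp add: v_def add_ac)
    also have "s S + (\<Sum>T\<in>B - {S}. s T) = (\<Sum>T\<in>B. s T)"
      using finite_B assms(2) by (rule sum.remove[symmetric])
    finally have eq: "(\<Sum>T\<in>B. (s(S := v)) T) = e *\<^sub>R (std_basis j - std_basis i) + (\<Sum>T\<in>B. s T)" .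
    have x: "x = (\<Sum>T\<in>B. s T)" using assms(1) unfolding decomp_def by blast
    have "\<forall>T\<in>B. (s(S := v)) T \<in> std_simplex T" using decompD(1)[OF assms(1)] v by simp
    then show ?thesis unfolding decomp_def eq x by (simp only: add.commute)
  qed
  then show ?thesis using assms(5) by (auto simp: feasible_def polytope_iff e_def)
qed

lemma simplex_difference:
  assumes "x \<in> std_simplex S" "y \<in> std_simplex S" "finite S"
  shows "x - y = (\<Sum>i\<in>S. \<Sum>j\<in>S. (x i * y j) *\<^sub>R (std_basis i - std_basis j))"
proof
  fix k
  have "(\<Sum>i\<in>S. \<Sum>j\<in>S. x i * y j * std_basis i k) = (\<Sum>i\<in>S. x i * std_basis i k) * sum y S"
    unfolding sum_product by (simp add: mult_ac)
  also have "\<dots> = x k"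
    using assms std_simplexD(2)[OF assms(1)] std_simplexD(3)[OF assms(2)]
    by (simp add: std_basis_def if_distrib cong: if_cong)
  finally have a: "(\<Sum>i\<in>S. \<Sum>j\<in>S. x i * y j * std_basis i k) = x k" .
  have "(\<Sum>i\<in>S. \<Sum>j\<in>S. x i * y j * std_basis j k) = sum x S * (\<Sum>j\<in>S. y j * std_basis j k)"
    unfolding sum_product by (simp add: mult_ac)
  also have "\<dots> = y k"
    using assms std_simplexD(2)[OF assms(2)] std_simplexD(3)[OF assms(1)]
    by (simp add: std_basis_def if_distrib cong: if_cong)
  finally have b: "(\<Sum>i\<in>S. \<Sum>j\<in>S. x i * y j * std_basis j k) = y k" .
  show "(x - y) k = (\<Sum>i\<in>S. \<Sum>j\<in>S. (x i * y j) *\<^sub>R (std_basis i - std_basis j)) k"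
    using a b by (simp add: sum_fun_apply scaleR_fun_def right_diff_distrib sum_subtractf)
qed

text \<open>
  This says that only the tight inequalities at \<open>x\<close> restrict the directions in which one can move
  inside the polytope. Write \<open>x - y\<close> as a nonnegative combination of directions from \<open>e_j\<close> to \<open>e_i\<close>, where \<open>i\<close> and \<open>j\<close> lie in a common set \<open>S\<close> and
  \<open>y\<close> has mass of \<open>S\<close> on \<open>j\<close>. The set \<open>R\<close> of all \<open>k\<close> for which the direction from \<open>e_j\<close> to \<open>e_k\<close>
  is feasible at \<open>x\<close> is closed under exchanges at \<open>x\<close>, which makes its component at \<open>j\<close> tight
  for \<open>x\<close>. Hence it is tight for \<open>y\<close>, and then it contains \<open>S\<close> and in particular \<open>i\<close>.
\<close>

lemma feasible_if_tight_subset: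
  assumes x: "x \<in> polytope" and y: "y \<in> polytope" and sub: "tight x \<subseteq> tight y"
  shows "x - y \<in> feasible x"
proof -
  obtain s r where s: "decomp s x" and r: "decomp r y"
    using x y by (auto simp: polytope_iff)
  have step: "std_basis i - std_basis j \<in> feasible x"
    if S: "S \<in> B" and i: "i \<in> S" and j: "j \<in> S" and pos: "r S j > 0" for S i j
  proof -
    define R where "R = {k \<in> V. std_basis k - std_basis j \<in> feasible x}"
    have jR: "j \<in> R" using j S B_subset feasible_0[OF x] by (auto simp: R_def)
    have closed: "T \<subseteq> R" if T: "T \<in> B" and k: "k \<in> R" "s T k \<noteq> 0" for T k
    proof
      fix l assume l: "l \<in> T"
      have sT: "s T \<in> std_simplex T" using decompD(1)[OF s T] .
      have "k \<in> T" "s T k > 0" using std_simplexD[OF sT] k(2) by (auto simp: less_le)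
      then have "std_basis l - std_basis k \<in> feasible x"
        using feasible_exchange[OF s T] l by auto
      then have "(std_basis l - std_basis k) + (std_basis k - std_basis j) \<in> feasible x"
        using k(1) x by (intro feasible_add) (auto simp: R_def)
      then show "l \<in> R" using l T B_subset by (auto simp: R_def)
    qed
    let ?C = "{I \<in> B. I \<subseteq> R \<and> j \<in> I}"
    have "finite ?C" "{j} \<in> ?C" using finite_B jR singleton_in by (auto simp: R_def)
    then obtain I where I: "I \<in> ?C" and max: "\<And>J. J \<in> ?C \<Longrightarrow> I \<subseteq> J \<Longrightarrow> J = I"
      using finite_has_maximal2[of ?C "{j}"] by (metis (no_types, lifting))
    have "I \<in> tight x"
    proof (rule tightI[OF s])
      show "I \<in> B" using I by auto
      fix T k assume T: "T \<in> B" "\<not> T \<subseteq> I" and k: "k \<in> I"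
      show "s T k = 0"
      proof (rule ccontr)
        assume nz: "s T k \<noteq> 0"
        have "k \<in> T" using std_simplexD(2)[OF decompD(1)[OF s T(1)]] nz by auto
        moreover have "T \<subseteq> R" using closed[OF T(1) _ nz] k I by auto
        ultimately have "I \<union> T \<in> ?C" using I T(1) k union_in[of I T] by auto
        then show False using max[of "I \<union> T"] T(2) by auto
      qed
    qed
    then have "S \<subseteq> I" using tightD[OF r _ S _ j] sub I pos by fastforce
    then show ?thesis using I i by (auto simp: R_def)
  qed
  have "x - y = (\<Sum>S\<in>B. s S - r S)"
    using s r by (simp add: decomp_def sum_subtractf)
  also have "\<dots> = (\<Sum>S\<in>B. \<Sum>i\<in>S. \<Sum>j\<in>S. (s S i * r S j) *\<^sub>R (std_basis i - std_basis j))"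
    by (intro sum.cong refl simplex_difference) (use decompD(1) s r finite_member in auto)
  also have "\<dots> \<in> feasible x"
  proof (intro feasible_sum[OF x])
    fix S i j assume *: "S \<in> B" "i \<in> S" "j \<in> S"
    have nn: "s S i \<ge> 0" "r S j \<ge> 0" using std_simplexD(1) decompD(1) s r * by blast+
    show "(s S i * r S j) *\<^sub>R (std_basis i - std_basis j) \<in> feasible x"
    proof (cases "r S j = 0")
      case True
      then show ?thesis using feasible_0[OF x] by simp
    next
      case False
      then show ?thesis using nn step[OF *] by (intro feasible_scale[OF x]) auto
    qed
  qed
  finally show ?thesis .
qed

section \<open>Faces and tubings\<close>

definition tube_face :: "nat set set \<Rightarrow> (nat \<Rightarrow> real) set" where
  "tube_face N = {y \<in> polytope. N \<subseteq> tight y}"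

lemma linear_sum_at: "sum (u *\<^sub>R a + v *\<^sub>R b) I = u * sum a I + v * sum b I"
  by (simp add: scaleR_fun_def sum.distrib sum_distrib_left)

lemma tight_convex_comb:
  assumes "a \<in> polytope" "b \<in> polytope" "0 < u" "0 < v" "u + v = 1"
  shows "tight (u *\<^sub>R a + v *\<^sub>R b) = tight a \<inter> tight b"
proof -
  have "sum (u *\<^sub>R a + v *\<^sub>R b) I = real (min_load I) \<longleftrightarrow>
        sum a I = real (min_load I) \<and> sum b I = real (min_load I)" (is "?l \<longleftrightarrow> ?r") if I: "I \<in> B" for I
  proof -
    let ?c = "real (min_load I)"
    have c: "?c \<le> sum a I" "?c \<le> sum b I"
      using min_load_le assms(1,2) B_subset[OF I] by auto
    have "?l \<longleftrightarrow> u * (sum a I - ?c) + v * (sum b I - ?c) = 0"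
      unfolding linear_sum_at using assms(5) by (auto simp: algebra_simps) (metis distrib_right mult_1)+
    also have "\<dots> \<longleftrightarrow> u * (sum a I - ?c) = 0 \<and> v * (sum b I - ?c) = 0"
      by (rule add_nonneg_eq_0_iff) (use c assms in auto)
    also have "\<dots> \<longleftrightarrow> ?r" using assms by auto
    finally show ?thesis .
  qed
  then show ?thesis by (auto simp: tight_def)
qed

lemma tube_face_face_of: "tube_face N face_of polytope"
  unfolding face_of_def
proof (intro conjI ballI impI)
  show "convex (tube_face N)"
  proof (rule convexI)
    fix x y and u v :: real
    assume xy: "x \<in> tube_face N" "y \<in> tube_face N" and uv: "0 \<le> u" "0 \<le> v" "u + v = 1"
    then consider "u = 0" "v = 1" | "v = 0" "u = 1" | "0 < u" "0 < v" by fastforce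
    then show "u *\<^sub>R x + v *\<^sub>R y \<in> tube_face N"
    proof cases
      case 3
      then have "tight (u *\<^sub>R x + v *\<^sub>R y) = tight x \<inter> tight y"
        using xy uv by (intro tight_convex_comb) (auto simp: tube_face_def)
      moreover have "u *\<^sub>R x + v *\<^sub>R y \<in> polytope"
        using xy uv by (intro convexD[OF convex_polytope]) (auto simp: tube_face_def)
      ultimately show ?thesis using xy by (auto simp: tube_face_def)
    qed (use xy in auto)
  qed
  fix a b x assume *: "a \<in> polytope" "b \<in> polytope" "x \<in> tube_face N" "x \<in> open_segment a b"
  then obtain u where "0 < u" "u < 1" "x = (1 - u) *\<^sub>R a + u *\<^sub>R b"
    unfolding in_segment by blast
  then have "tight x = tight a \<inter> tight b"
    using tight_convex_comb[of a b "1 - u" u] * by auto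
  then show "a \<in> tube_face N" "b \<in> tube_face N" using * by (auto simp: tube_face_def)
qed (auto simp: tube_face_def)

text \<open>
  A point of the face with the fewest tight sets plays the part of a relative interior point:
  from it one can move a little away from any other point of the face of its tight sets.
\<close>

lemma face_eq_tube_face:
  assumes F: "F face_of polytope" "F \<noteq> {}"
  obtains x where "x \<in> F" "F = tube_face (tight x)"
proof -
  have sub: "F \<subseteq> polytope" using F face_of_imp_subset by auto
  have fin: "finite (tight x)" for x using finite_B by (simp add: tight_def)
  obtain x where x: "x \<in> F" and min: "\<And>z. z \<in> F \<Longrightarrow> card (tight x) \<le> card (tight z)"
    using ex_has_least_nat[of "\<lambda>x. x \<in> F" _ "\<lambda>x. card (tight x)"] F(2) by (metis ex_in_conv)
  have le: "tight x \<subseteq> tight y" if y: "y \<in> F" for y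
  proof -
    let ?z = "(1/2) *\<^sub>R x + (1/2) *\<^sub>R y"
    have "?z \<in> F" using x y face_of_imp_convex[OF F(1)] by (intro convexD) auto
    then have "card (tight x) \<le> card (tight ?z)" using min by blast
    moreover have "tight ?z = tight x \<inter> tight y" using x y sub by (intro tight_convex_comb) auto
    ultimately show ?thesis using fin by (metis card_seteq inf_le1 inf.orderI inf_commute)
  qed
  have "y \<in> F" if y: "y \<in> polytope" "tight x \<subseteq> tight y" for y
  proof (cases "y = x")
    case False
    obtain e where e: "e > 0" "x + e *\<^sub>R (x - y) \<in> polytope"
      using feasible_if_tight_subset[OF _ y] x sub by (auto simp: feasible_def)
    have "x = (1 - 1/(1+e)) *\<^sub>R y + (1/(1+e)) *\<^sub>R (x + e *\<^sub>R (x - y))"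
    proof
      fix k
      have "(1 - 1/(1+e)) * y k + (1/(1+e)) * (x k + e * (x k - y k)) = ((1 + e) * x k) / (1 + e)"
        using e by (simp add: divide_simps) (simp add: algebra_simps)
      then show "x k = ((1 - 1/(1+e)) *\<^sub>R y + (1/(1+e)) *\<^sub>R (x + e *\<^sub>R (x - y))) k"
        using e by (simp add: scaleR_fun_def)
    qed
    moreover have "y \<noteq> x + e *\<^sub>R (x - y)"
    proof
      assume "y = x + e *\<^sub>R (x - y)"
      then have "(1 + e) *\<^sub>R (x - y) = 0" by (simp add: algebra_simps)
      then show False using e False by auto
    qed
    ultimately have "x \<in> open_segment y (x + e *\<^sub>R (x - y))"
      unfolding in_segment using e by (auto intro!: exI[of _ "1/(1+e)"])
    then show ?thesis using face_ofD[OF F(1) _ y(1) e(2)] x by auto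
  qed (use x in simp)
  then have "F = tube_face (tight x)" using le sub by (auto simp: tube_face_def)
  then show ?thesis using that x by blast
qed

context
  fixes N :: "nat set set"
  assumes N: "N \<in> tubings V B"
begin

lemma N_subset: "N \<subseteq> B" and V_in_N: "V \<in> N"
  using N by (auto simp: tubings_def nested_def)

lemma tubes_comparable: "I \<in> N \<Longrightarrow> J \<in> N \<Longrightarrow> I \<inter> J \<noteq> {} \<Longrightarrow> I \<subseteq> J \<or> J \<subseteq> I"
  using N union_in[of I J] unfolding tubings_def nested_def by blast

definition tube_hull :: "nat set \<Rightarrow> nat set" where
  "tube_hull S = \<Inter>{I \<in> N. S \<subseteq> I}"

lemma tube_hull:
  assumes "S \<in> B"
  shows "tube_hull S \<in> N" "S \<subseteq> tube_hull S" "I \<in> N \<Longrightarrow> S \<subseteq> I \<Longrightarrow> tube_hull S \<subseteq> I"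
proof -
  let ?C = "{I \<in> N. S \<subseteq> I}"
  have "finite ?C" "V \<in> ?C"
    using finite_subset[OF N_subset finite_B] V_in_N B_subset assms by auto
  then obtain M where M: "M \<in> ?C" and min: "\<And>I. I \<in> ?C \<Longrightarrow> I \<subseteq> M \<Longrightarrow> I = M"
    using finite_has_minimal2[of ?C V] by (metis (no_types, lifting))
  have "M \<subseteq> I" if "I \<in> ?C" for I
    using tubes_comparable[of I M] that M min[OF that] B_nonempty[OF assms] by blast
  then have "tube_hull S = M" using M by (auto simp: tube_hull_def)
  then show "tube_hull S \<in> N" "S \<subseteq> tube_hull S" using M by auto
qed (auto simp: tube_hull_def)

lemma tube_hull_tube: "J \<in> N \<Longrightarrow> tube_hull J = J"
  by (auto simp: tube_hull_def)

definition block :: "nat set \<Rightarrow> nat set" where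
  "block J = {i \<in> V. tube_hull {i} = J}"

lemma block_subset: "block J \<subseteq> J"
  using tube_hull(2)[OF singleton_in] by (auto simp: block_def)

lemma block_tube_subset: "I \<in> N \<Longrightarrow> i \<in> I \<Longrightarrow> i \<in> block J \<Longrightarrow> J \<subseteq> I"
  using tube_hull(3)[OF singleton_in, of i I] by (auto simp: block_def)

text \<open>Otherwise \<open>S\<close> would be covered by smaller tubes, hence would lie inside one of them.\<close>

lemma block_meets:
  assumes S: "S \<in> B"
  shows "S \<inter> block (tube_hull S) \<noteq> {}"
proof
  assume empty: "S \<inter> block (tube_hull S) = {}"
  let ?C = "{I \<in> N. I \<subset> tube_hull S}"
  have "i \<in> \<Union>?C" if i: "i \<in> S" for i
  proof -
    have iV: "i \<in> V" using i S B_subset by auto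
    have "tube_hull {i} \<subseteq> tube_hull S"
      using tube_hull(1,2)[OF S] i by (intro tube_hull(3)[OF singleton_in[OF iV]]) auto
    moreover have "tube_hull {i} \<noteq> tube_hull S" using i iV empty by (auto simp: block_def)
    ultimately show ?thesis using tube_hull(1,2)[OF singleton_in[OF iV]] by auto
  qed
  then have "S \<subseteq> \<Union>?C" by auto
  moreover have "?C \<subseteq> B" using N_subset by auto
  moreover have "I \<subseteq> J \<or> J \<subseteq> I \<or> I \<union> J \<notin> B" if "I \<in> ?C" "J \<in> ?C" for I J
    using N that by (auto simp: tubings_def nested_def)
  ultimately obtain I where "I \<in> ?C" "S \<subseteq> I" using covered[OF S, of ?C] by auto
  then show False using tube_hull(3)[OF S, of I] by auto
qed

definition pick :: "nat set \<Rightarrow> nat" where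
  "pick S = (SOME i. i \<in> S \<inter> block (tube_hull S))"

lemma pick:
  assumes "S \<in> B"
  shows "pick S \<in> S" "pick S \<in> block (tube_hull S)"
  using someI_ex[of "\<lambda>i. i \<in> S \<inter> block (tube_hull S)"] block_meets[OF assms]
  by (auto simp: pick_def)

lemma tube_hull_pick: "J \<in> N \<Longrightarrow> tube_hull {pick J} = J"
  using pick(2)[of J] N_subset by (auto simp: block_def tube_hull_tube)

lemma tight_if_block_supported:
  assumes "decomp s x" "\<And>S i. S \<in> B \<Longrightarrow> s S i \<noteq> 0 \<Longrightarrow> i \<in> block (tube_hull S)"
  shows "N \<subseteq> tight x"
proof
  fix I assume I: "I \<in> N"
  show "I \<in> tight x"
  proof (rule tightI[OF assms(1)])
    fix S i assume S: "S \<in> B" "\<not> S \<subseteq> I" and i: "i \<in> I"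
    show "s S i = 0"
      using assms(2)[OF S(1), of i] block_tube_subset[OF I i, of "tube_hull S"] tube_hull(2)[OF S(1)] S(2)
      by blast
  qed (use I N_subset in auto)
qed

text \<open>
  Letting every simplex \<open>S\<close> spread its mass evenly over the part of \<open>S\<close> in the block of its
  smallest enclosing tube makes the tubes, and nothing else, tight.
\<close>

lemma tubing_is_tight: "\<exists>x\<in>polytope. tight x = N"
proof -
  define A where "A S = S \<inter> block (tube_hull S)" for S
  define s where "s S = (\<lambda>i. if i \<in> A S then 1 / real (card (A S)) else 0)" for S
  define x where "x = (\<Sum>S\<in>B. s S)"
  have card: "card (A S) > 0" if "S \<in> B" for S
    using block_meets[OF that] finite_member[OF that] by (auto simp: A_def card_gt_0_iff)
  have "s S \<in> std_simplex S" if S: "S \<in> B" for S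
  proof -
    have "sum (s S) S = (\<Sum>i\<in>A S. 1 / real (card (A S)))"
      using finite_member[OF S] by (auto simp: s_def A_def sum.inter_restrict[symmetric] Int_def)
    also have "\<dots> = 1" using card[OF S] by simp
    finally show ?thesis by (auto simp: std_simplex_def s_def A_def)
  qed
  then have x: "decomp s x" by (simp add: decomp_def x_def)
  have "N \<subseteq> tight x"
    by (rule tight_if_block_supported[OF x]) (auto simp: s_def A_def split: if_splits)
  moreover have "I \<in> N" if I: "I \<in> tight x" for I
  proof -
    have IB: "I \<in> B" using I by (auto simp: tight_def)
    define J where "J = tube_hull I"
    have J: "J \<in> N" "J \<in> B" "I \<subseteq> J" using tube_hull[OF IB] N_subset by (auto simp: J_def)
    obtain i where i: "i \<in> I" "i \<in> block J" using block_meets[OF IB] by (auto simp: J_def)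
    then have "i \<in> A J" using J by (auto simp: A_def tube_hull_tube)
    then have "s J i \<noteq> 0" using card[OF J(2)] by (simp add: s_def)
    then have "J \<subseteq> I" using tightD[OF x I J(2)] i J by auto
    then show ?thesis using J by auto
  qed
  ultimately have "tight x = N" by blast
  then show ?thesis using x polytope_iff by blast
qed

text \<open>A tube is the disjoint union of the blocks of the tubes inside it.\<close>

lemma block_sums_zero:
  assumes d: "\<And>I. I \<in> N \<Longrightarrow> sum d I = (0::real)" and "J \<in> N"
  shows "sum d (block J) = 0"
  using \<open>J \<in> N\<close>
proof (induction "card J" arbitrary: J rule: less_induct)
  case less
  have fJ: "finite J" using less.prems N_subset finite_member by auto
  have JV: "J \<subseteq> V" using less.prems N_subset B_subset by auto
  let ?T = "{I \<in> N. I \<subseteq> J}"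
  have fT: "finite ?T" using finite_subset[OF N_subset finite_B] by auto
  have img: "(\<lambda>i. tube_hull {i}) ` J \<subseteq> ?T"
    using tube_hull(1,3)[OF singleton_in] JV less.prems by auto
  have eq: "{i \<in> J. tube_hull {i} = I} = block I" if "I \<in> ?T" for I
    using that JV block_subset[of I] by (auto simp: block_def)
  have "sum d J = (\<Sum>I\<in>?T. sum d {i \<in> J. tube_hull {i} = I})"
    by (rule sum.group[OF fJ fT img, symmetric])
  also have "\<dots> = (\<Sum>I\<in>?T. sum d (block I))" using eq by (intro sum.cong) auto
  also have "\<dots> = sum d (block J) + (\<Sum>I\<in>?T - {J}. sum d (block I))"
    using fT less.prems by (intro sum.remove) auto
  also have "(\<Sum>I\<in>?T - {J}. sum d (block I)) = 0"
    using less.hyps psubset_card_mono[OF fJ] by (intro sum.neutral) auto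
  finally show ?case using d[OF less.prems] by simp
qed

lemma card_non_roots: "card {i \<in> V. i \<noteq> pick (tube_hull {i})} = card V - card N"
proof -
  have eq: "{i \<in> V. i \<noteq> pick (tube_hull {i})} = V - pick ` N"
    using tube_hull(1)[OF singleton_in] tube_hull_pick by (auto simp: image_iff)
  have "inj_on pick N" using tube_hull_pick by (metis inj_onI)
  moreover have "pick ` N \<subseteq> V" using pick(1) N_subset B_subset by blast
  ultimately show ?thesis
    unfolding eq using finite_V by (simp add: card_Diff_subset finite_subset card_image)
qed

lemma card_tubing_le: "card N \<le> card V"
proof -
  have "inj_on pick N" using tube_hull_pick by (metis inj_onI)
  moreover have "pick ` N \<subseteq> V" using pick(1) N_subset B_subset by blast
  ultimately show ?thesis using finite_V card_inj_on_le by blast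
qed

text \<open>
  The differences of points of the face span the space of vectors on \<open>V\<close> whose sum over each tube,
  hence over each block, is zero. Subtracting from each basis vector that of the root of its block
  gives a basis of this space, with one vector for each element of \<open>V\<close> that is no root.
\<close>

lemma affdim_tube_face: "affdim (tube_face N) = card V - card N"
proof -
  define root where "root i = pick (tube_hull {i})" for i
  define A where "A = {i \<in> V. i \<noteq> root i}"
  define b where "b i = std_basis i - std_basis (root i)" for i
  have root_root: "root (root i) = root i" if "i \<in> V" for i
    using tube_hull_pick[OF tube_hull(1)[OF singleton_in[OF that]]] by (simp add: root_def)
  have fA: "finite A" using finite_V by (simp add: A_def)
  have b_at: "b k i = (if k = i then 1 else 0)" if "i \<in> A" "k \<in> A" for i k
    using that root_root[of k] by (auto simp: b_def std_basis_def A_def)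
  have inj: "inj_on b A"
    by (rule inj_onI) (metis b_at zero_neq_one)
  have indep: "independent (b ` A)"
  proof (rule real_vector.independent_if_scalars_zero)
    fix f :: "(nat \<Rightarrow> real) \<Rightarrow> real" and v assume z: "(\<Sum>v\<in>b ` A. f v *\<^sub>R v) = 0" and "v \<in> b ` A"
    then obtain i where i: "i \<in> A" "v = b i" by auto
    have "0 = (\<Sum>k\<in>A. f (b k) *\<^sub>R b k) i" using z by (simp add: sum.reindex[OF inj])
    also have "\<dots> = (\<Sum>k\<in>A. f (b k) * (if k = i then 1 else 0))"
      using b_at[OF i(1)] by (simp add: sum_fun_apply scaleR_fun_def)
    also have "\<dots> = f v" using i fA by (simp add: if_distrib cong: if_cong)
    finally show "f v = 0" by simp
  qed (use fA in auto)
  have b_span: "b i \<in> span (b ` A)" if "i \<in> V" for i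
    using that by (cases "i = root i") (auto simp: b_def A_def real_vector.span_zero intro: real_vector.span_base)
  define D where "D = {x - y | x y. x \<in> tube_face N \<and> y \<in> tube_face N}"
  have "b ` A \<subseteq> D"
  proof safe
    fix i assume i: "i \<in> A"
    then have iV: "i \<in> V" by (auto simp: A_def)
    define J where "J = tube_hull {i}"
    have J: "J \<in> N" "J \<in> B" "i \<in> J" "tube_hull J = J"
      using tube_hull[OF singleton_in[OF iV]] N_subset tube_hull_tube by (auto simp: J_def)
    define s where "s S = std_basis (pick S)" for S
    define s' where "s' = s(J := std_basis i)"
    have s: "decomp s (sum s B)"
      using pick(1) finite_member std_basis_in_std_simplex by (auto simp: decomp_def s_def)
    have s': "decomp s' (sum s' B)"
      using pick(1) finite_member std_basis_in_std_simplex J by (auto simp: decomp_def s'_def s_def)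
    have "N \<subseteq> tight (sum s B)"
      by (rule tight_if_block_supported[OF s])
        (use pick(2) in \<open>auto simp: s_def std_basis_def split: if_splits\<close>)
    moreover have "N \<subseteq> tight (sum s' B)"
      by (rule tight_if_block_supported[OF s'])
        (use pick(2) J iV in \<open>auto simp: s_def s'_def std_basis_def block_def J_def split: if_splits\<close>)
    ultimately have face: "sum s B \<in> tube_face N" "sum s' B \<in> tube_face N"
      using s s' by (auto simp: tube_face_def polytope_iff)
    have "sum s' B - sum s B = (\<Sum>S\<in>B. s' S - s S)" by (simp only: sum_subtractf)
    also have "\<dots> = (\<Sum>S\<in>B. if S = J then b i else 0)"
      by (intro sum.cong refl) (simp add: s'_def s_def b_def root_def J_def)
    also have "\<dots> = b i" using finite_B J by simp
    finally have "b i = sum s' B - sum s B" by simp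
    then show "b i \<in> D" using face unfolding D_def by (intro CollectI exI conjI)
  qed
  moreover have "D \<subseteq> span (b ` A)"
  proof
    fix d assume "d \<in> D"
    then obtain x y where d: "d = x - y" and xy: "x \<in> tube_face N" "y \<in> tube_face N"
      unfolding D_def by blast
    have out: "d i = 0" if "i \<notin> V" for i
      using xy polytope_outside[of x i] polytope_outside[of y i] that by (auto simp: d tube_face_def)
    have "sum d I = 0" if "I \<in> N" for I
      using xy that by (auto simp: d sum_subtractf tube_face_def tight_def subset_iff)
    then have zero: "sum d (block J) = 0" if "J \<in> N" for J using block_sums_zero that by blast
    have "d = (\<Sum>i\<in>V. d i *\<^sub>R std_basis i)" using std_simplex_expand[OF finite_V] out by blast
    also have "\<dots> = (\<Sum>i\<in>V. d i *\<^sub>R b i + d i *\<^sub>R std_basis (root i))"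
      by (intro sum.cong refl) (simp add: b_def scaleR_right_diff_distrib)
    also have "\<dots> = (\<Sum>i\<in>V. d i *\<^sub>R b i) + (\<Sum>i\<in>V. d i *\<^sub>R std_basis (root i))"
      by (rule sum.distrib)
    also have "(\<Sum>i\<in>V. d i *\<^sub>R std_basis (root i))
        = (\<Sum>J\<in>N. \<Sum>i\<in>{i \<in> V. tube_hull {i} = J}. d i *\<^sub>R std_basis (root i))"
      by (rule sum.group[symmetric])
        (use finite_V finite_subset[OF N_subset finite_B] tube_hull(1)[OF singleton_in] in auto)
    also have "\<dots> = (\<Sum>J\<in>N. sum d (block J) *\<^sub>R std_basis (pick J))"
      unfolding block_def[symmetric]
    proof (intro sum.cong refl)
      fix J
      have "(\<Sum>i\<in>block J. d i *\<^sub>R std_basis (root i)) = (\<Sum>i\<in>block J. d i *\<^sub>R std_basis (pick J))"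
        by (intro sum.cong refl) (simp add: block_def root_def)
      also have "\<dots> = sum d (block J) *\<^sub>R std_basis (pick J)" by (rule scaleR_sum_left[symmetric])
      finally show "(\<Sum>i\<in>block J. d i *\<^sub>R std_basis (root i)) = sum d (block J) *\<^sub>R std_basis (pick J)" .
    qed
    also have "\<dots> = 0" using zero by simp
    also have "(\<Sum>i\<in>V. d i *\<^sub>R b i) + 0 = (\<Sum>i\<in>V. d i *\<^sub>R b i)" by (rule add_0_right)
    finally have "d = (\<Sum>i\<in>V. d i *\<^sub>R b i)" .
    also have "\<dots> \<in> span (b ` A)"
      by (intro real_vector.span_sum real_vector.span_scale b_span)
    finally show "d \<in> span (b ` A)" .
  qed
  moreover have "card (b ` A) = card V - card N"
    using card_non_roots unfolding card_image[OF inj] by (simp add: A_def root_def)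
  ultimately show ?thesis
    unfolding affdim_def D_def[symmetric] using indep by (intro real_vector.dim_unique)
qed

end

lemma tube_face_subset_iff:
  assumes "N \<in> tubings V B"
  shows "tube_face N \<subseteq> tube_face N' \<longleftrightarrow> N' \<subseteq> N"
  using tubing_is_tight[OF assms] by (auto simp: tube_face_def)

lemma tubing_V: "{V} \<in> tubings V B"
  using V_in by (auto simp: tubings_def nested_def)

lemma affdim_polytope: "affdim polytope = card V - 1"
proof -
  have "polytope = tube_face {V}"
    using tight_in_tubings by (auto simp: tube_face_def tubings_def)
  then show ?thesis using affdim_tube_face[OF tubing_V] by simp
qed

lemma num_faces_polytope: "num_faces polytope i = card {N \<in> tubings V B. card V - card N = i}"
proof -
  have "{F. F face_of polytope \<and> F \<noteq> {} \<and> affdim F = i} =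
        tube_face ` {N \<in> tubings V B. card V - card N = i}" (is "?L = ?R")
  proof
    show "?L \<subseteq> ?R"
    proof
      fix F assume F: "F \<in> ?L"
      then obtain x where "x \<in> F" "F = tube_face (tight x)" using face_eq_tube_face by blast
      moreover have "tight x \<in> tubings V B"
        using F \<open>x \<in> F\<close> face_of_imp_subset tight_in_tubings by blast
      ultimately show "F \<in> ?R" using F affdim_tube_face by auto
    qed
    show "?R \<subseteq> ?L"
      using tube_face_face_of affdim_tube_face tubing_is_tight
      by (auto simp: tube_face_def[symmetric]) (metis (mono_tags, lifting) empty_iff mem_Collect_eq subset_refl tube_face_def)
  qed
  moreover have "inj_on tube_face {N \<in> tubings V B. card V - card N = i}"
    by (rule inj_onI) (metis (mono_tags, lifting) mem_Collect_eq order_antisym subset_refl tube_face_subset_iff)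
  ultimately show ?thesis by (simp add: num_faces_def card_image)
qed

lemma finite_tubings: "finite (tubings V B)"
  by (rule finite_subset[of _ "Pow B"]) (use finite_B in \<open>auto simp: tubings_def nested_def\<close>)

lemma card_tubing_bounds:
  assumes "N \<in> tubings V B"
  shows "1 \<le> card N" "card N \<le> card V"
  using assms card_tubing_le[OF assms] finite_subset[OF _ finite_B]
  by (auto simp: tubings_def nested_def Suc_le_eq card_gt_0_iff)

lemma F_expr_polytope:
  fixes a t :: "'a::comm_ring_1"
  shows "F_expr polytope a t = (\<Sum>N\<in>tubings V B. a ^ (card V - card N) * t ^ (card N - 1))"
proof -
  have "(\<Sum>N\<in>tubings V B. a ^ (card V - card N) * t ^ (card N - 1)) =
        (\<Sum>i\<le>card V - 1. \<Sum>N\<in>{N \<in> tubings V B. card V - card N = i}. a ^ (card V - card N) * t ^ (card N - 1))"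
    by (rule sum.group[symmetric]) (use finite_tubings card_tubing_bounds in \<open>auto intro: diff_le_mono2\<close>)
  also have "\<dots> = (\<Sum>i\<le>card V - 1. of_nat (num_faces polytope i) * a ^ i * t ^ (card V - 1 - i))"
  proof (intro sum.cong refl)
    fix i
    have "card N - 1 = card V - 1 - i" if "N \<in> tubings V B" "card V - card N = i" for N
      using card_tubing_bounds[OF that(1)] that(2) by auto
    then have "(\<Sum>N\<in>{N \<in> tubings V B. card V - card N = i}. a ^ (card V - card N) * t ^ (card N - 1))
        = (\<Sum>N\<in>{N \<in> tubings V B. card V - card N = i}. a ^ i * t ^ (card V - 1 - i))"
      by (intro sum.cong) auto
    then show "(\<Sum>N\<in>{N \<in> tubings V B. card V - card N = i}. a ^ (card V - card N) * t ^ (card N - 1))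
        = of_nat (num_faces polytope i) * a ^ i * t ^ (card V - 1 - i)"
      by (simp add: num_faces_polytope mult.assoc)
  qed
  finally show ?thesis by (simp add: F_expr_def affdim_polytope)
qed

end

section \<open>Intervals as the tubes of a path\<close>

definition intervals :: "nat \<Rightarrow> nat \<Rightarrow> nat set set" where
  "intervals a b = {{c..<d} | c d. a \<le> c \<and> c < d \<and> d \<le> b}"

lemma intervalI: "a \<le> c \<Longrightarrow> c < d \<Longrightarrow> d \<le> b \<Longrightarrow> {c..<d} \<in> intervals a b"
  by (auto simp: intervals_def)

lemma intervalE:
  assumes "I \<in> intervals a b"
  obtains c d where "I = {c..<d}" "a \<le> c" "c < d" "d \<le> b"
  using assms by (auto simp: intervals_def)

lemma union_touching_intervals:
  fixes c d c' d' :: nat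
  assumes "c' \<le> d" "c \<le> d'" "c < d" "c' < d'"
  shows "{c..<d} \<union> {c'..<d'} = {min c c'..<max d d'}"
  using assms by auto

lemma union_touching_in_intervals:
  assumes "{c..<d} \<in> intervals a b" "{c'..<d'} \<in> intervals a b" "c' \<le> d" "c \<le> d'" "c < d" "c' < d'"
  shows "{c..<d} \<union> {c'..<d'} \<in> intervals a b"
proof -
  have "a \<le> c" "d \<le> b" "a \<le> c'" "d' \<le> b"
    using assms by (auto elim!: intervalE simp: atLeastLessThan_eq_iff)
  then show ?thesis
    using assms by (auto simp: union_touching_intervals intro!: intervalI)
qed

lemma graphical_family_intervals:
  assumes "a < b"
  shows "graphical_family {a..<b} (intervals a b)"
proof
  fix I J assume I: "I \<in> intervals a b" and J: "J \<in> intervals a b" and ne: "I \<inter> J \<noteq> {}"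
  obtain c d where I': "I = {c..<d}" "c < d" using I by (rule intervalE)
  obtain c' d' where J': "J = {c'..<d'}" "c' < d'" using J by (rule intervalE)
  show "I \<union> J \<in> intervals a b"
    unfolding I' J' by (rule union_touching_in_intervals) (use I J ne I' J' in auto)
next
  fix S C assume S: "S \<in> intervals a b" and C: "C \<subseteq> intervals a b" and cov: "S \<subseteq> \<Union>C"
    and nest: "\<And>I J. I \<in> C \<Longrightarrow> J \<in> C \<Longrightarrow> I \<subseteq> J \<or> J \<subseteq> I \<or> I \<union> J \<notin> intervals a b"
  obtain l u where lu: "S = {l..<u}" "l < u" using S by (rule intervalE)
  \<comment> \<open>Among the sets that contain the left end of \<open>S\<close>, a largest one must reach the right end: the
    set that covers the next point would touch it, hence contain it.\<close>
  let ?D = "{I \<in> C. l \<in> I}"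
  have "intervals a b \<subseteq> Pow {a..<b}" by (auto simp: intervals_def)
  then have "finite C" using C by (meson finite_Pow_iff finite_atLeastLessThan finite_subset)
  then have "finite ?D" by simp
  moreover have "?D \<noteq> {}" using cov lu by auto
  ultimately obtain I where I: "I \<in> ?D" and max: "\<And>J. J \<in> ?D \<Longrightarrow> I \<subseteq> J \<Longrightarrow> J = I"
    using finite_has_maximal[of ?D] by metis
  have IB: "I \<in> intervals a b" using I C by auto
  obtain c d where cd: "I = {c..<d}" "c < d" using IB by (rule intervalE)
  have "u \<le> d"
  proof (rule ccontr)
    assume "\<not> u \<le> d"
    then have "d \<in> S" using lu I cd by auto
    then obtain J where J: "J \<in> C" "d \<in> J" using cov by auto
    have JB: "J \<in> intervals a b" using J C by auto
    obtain c' d' where cd': "J = {c'..<d'}" "c' < d'" using JB by (rule intervalE)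
    have "I \<union> J \<in> intervals a b"
      unfolding cd cd' by (rule union_touching_in_intervals) (use IB JB cd cd' J in auto)
    then have "I \<subseteq> J \<or> J \<subseteq> I" using nest[of I J] I J by auto
    then have "I \<subseteq> J" using J cd by auto
    then have "J = I" using max[of J] J I by auto
    then show False using J cd by auto
  qed
  then have "S \<subseteq> I" using lu cd I by auto
  then show "\<exists>I\<in>C. S \<subseteq> I" using I by auto
next
  fix i assume i: "i \<in> {a..<b}"
  have "{i..<Suc i} \<in> intervals a b" using i by (intro intervalI) auto
  then show "{i} \<in> intervals a b" by simp
qed (use assms in \<open>auto simp: intervals_def\<close>)

lemma building_set_path: "building_set m (path_graph m) = intervals 1 (Suc m)"
proof (intro set_eqI iffI)
  fix S assume "S \<in> building_set m (path_graph m)"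
  then have S: "S \<subseteq> {1..m}" "S \<noteq> {}" and conn: "\<And>u v. u \<in> S \<Longrightarrow> v \<in> S \<Longrightarrow>
      (u, v) \<in> {(x, y). x \<in> S \<and> y \<in> S \<and> {x, y} \<in> path_graph m}\<^sup>*"
    by (auto simp: building_set_def induced_connected_def)
  have fin: "finite S" using S finite_subset by blast
  have mem: "Min S \<in> S" "Max S \<in> S" using S fin by auto
  \<comment> \<open>A walk from the minimum moves right by at most one at each step, so it cannot pass a gap.\<close>
  have "S = {Min S..<Suc (Max S)}"
  proof
    show "{Min S..<Suc (Max S)} \<subseteq> S"
    proof
      fix c assume c: "c \<in> {Min S..<Suc (Max S)}"
      show "c \<in> S"
      proof (rule ccontr)
        assume nc: "c \<notin> S"
        have "v < c" if "(Min S, v) \<in> {(x, y). x \<in> S \<and> y \<in> S \<and> {x, y} \<in> path_graph m}\<^sup>*" for v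
          using that
        proof (induction rule: rtrancl_induct)
          case base
          then show ?case using c nc mem by (metis atLeastLessThan_iff le_neq_implies_less)
        next
          case (step y z)
          then have "z \<noteq> c" "z \<le> Suc y" using nc by (auto simp: path_graph_def doubleton_eq_iff)
          then show ?case using step by linarith
        qed
        from this[OF conn[OF mem]] show False using c by auto
      qed
    qed
  qed (use fin in \<open>auto simp: less_Suc_eq_le\<close>)
  then show "S \<in> intervals 1 (Suc m)"
    using mem S by (metis Suc_le_mono atLeastAtMost_iff fin Max_ge intervalI less_Suc_eq_le subsetD)
next
  fix S assume "S \<in> intervals 1 (Suc m)"
  then obtain c d where S: "S = {c..<d}" "1 \<le> c" "c < d" "d \<le> Suc m" by (rule intervalE)
  let ?r = "{(x, y). x \<in> S \<and> y \<in> S \<and> {x, y} \<in> path_graph m}"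
  have up: "(u, u + k) \<in> ?r\<^sup>*" if "u \<in> S" "u + k \<in> S" for u k
    using that
  proof (induction k)
    case (Suc k)
    then have "u + k \<in> S" using S by auto
    moreover have "(u + k, u + Suc k) \<in> ?r"
      using Suc.prems S by (auto simp: path_graph_def)
    ultimately show ?case using Suc by (meson rtrancl.rtrancl_into_rtrancl)
  qed simp
  have "sym ?r" by (auto simp: sym_def insert_commute)
  then have symm: "sym (?r\<^sup>*)" by (rule sym_rtrancl)
  have "(u, v) \<in> ?r\<^sup>*" if "u \<in> S" "v \<in> S" for u v
  proof (cases "u \<le> v")
    case True
    then show ?thesis using up[of u "v - u"] that by simp
  next
    case False
    then have "(v, u) \<in> ?r\<^sup>*" using up[of v "u - v"] that by simp
    then show ?thesis using symm by (rule symD[rotated])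
  qed
  then show "S \<in> building_set m (path_graph m)"
    using S by (auto simp: building_set_def induced_connected_def)
qed

section \<open>Counting tubings of a path\<close>

definition tubing_sum :: "'a::comm_ring_1 \<Rightarrow> 'a \<Rightarrow> nat \<Rightarrow> nat \<Rightarrow> 'a" where
  "tubing_sum x t a b =
     (\<Sum>N\<in>tubings {a..<b} (intervals a b). x ^ (b - a - card N) * t ^ (card N - 1))"

lemma associahedron_eq:
  "associahedron n = graphical_family.polytope (intervals 1 (n + 2))"
proof -
  interpret graphical_family "{1..<n + 2}" "intervals 1 (n + 2)"
    by (rule graphical_family_intervals) simp
  have "associahedron n = (\<Sum>S\<in>intervals 1 (n + 2). convex hull (std_basis ` S))"
    by (simp add: associahedron_def graph_associahedron_def building_set_path)
  also have "\<dots> = polytope"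
    unfolding polytope_def by (intro sum.cong refl convex_hull_std_basis finite_member)
  finally show ?thesis .
qed

lemma affdim_associahedron: "affdim (associahedron n) = n"
  using graphical_family.affdim_polytope[OF graphical_family_intervals[of 1 "n + 2"]]
  by (simp add: associahedron_eq)

lemma F_expr_associahedron:
  fixes a t :: "'a::comm_ring_1"
  shows "F_expr (associahedron n) a t = tubing_sum a t 1 (n + 2)"
  using graphical_family.F_expr_polytope[OF graphical_family_intervals[of 1 "n + 2"], of a t]
  by (simp add: associahedron_eq tubing_sum_def)

text \<open>
  Forests are the nested families in which the whole interval need not occur; they describe what
  lies on one side of a cut. In a full forest the whole interval is present unless it is empty.
\<close>

definition forests :: "nat \<Rightarrow> nat \<Rightarrow> nat set set set" where
  "forests a b = {M. nested (intervals a b) M}"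

definition forest_sum :: "'a::comm_ring_1 \<Rightarrow> 'a \<Rightarrow> nat \<Rightarrow> nat \<Rightarrow> 'a" where
  "forest_sum x t a b = (\<Sum>M\<in>forests a b. x ^ (b - a - card M) * t ^ card M)"

definition full_forests :: "nat \<Rightarrow> nat \<Rightarrow> nat set set set" where
  "full_forests a b = {M \<in> forests a b. a < b \<longrightarrow> {a..<b} \<in> M}"

lemma forestD:
  assumes "M \<in> forests a b" "I \<in> M"
  shows "I \<subseteq> {a..<b}" "I \<noteq> {}" "I \<in> intervals a b"
  using assms by (auto simp: forests_def nested_def intervals_def)

lemma intervals_mono: "a' \<le> a \<Longrightarrow> b \<le> b' \<Longrightarrow> intervals a b \<subseteq> intervals a' b'"
  by (force simp: intervals_def)

lemma intervals_empty: "intervals a a = {}"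
  by (auto simp: intervals_def)

lemma finite_forest:
  assumes "M \<in> forests a b"
  shows "finite M"
proof (rule finite_subset)
  show "M \<subseteq> Pow {a..<b}" using forestD(1)[OF assms] by auto
qed simp

lemma insert_top_forest:
  assumes "M \<in> forests a b" "a < b"
  shows "insert {a..<b} M \<in> tubings {a..<b} (intervals a b)"
  using assms forestD(1)[OF assms(1)] intervalI[of a a b b]
  by (auto simp: forests_def tubings_def nested_def)

lemma tubing_is_forest: "N \<in> tubings {a..<b} (intervals a b) \<Longrightarrow> N \<in> forests a b"
  by (auto simp: forests_def tubings_def)

lemma card_forest_le:
  assumes "M \<in> forests a b"
  shows "card M \<le> b - a"
proof (cases "a < b")
  case True
  have "card M \<le> card (insert {a..<b} M)"
    using finite_forest[OF assms] by (intro card_mono) auto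
  also have "\<dots> \<le> card {a..<b}"
    by (rule graphical_family.card_tubing_le[OF graphical_family_intervals[OF True] insert_top_forest[OF assms True]])
  finally show ?thesis by simp
next
  case False
  then have "M = {}" using assms by (auto simp: forests_def nested_def intervals_def)
  then show ?thesis by simp
qed

lemma forest_sum_empty: "forest_sum x t a a = 1"
proof -
  have "forests a a = {{}}" by (auto simp: forests_def nested_def intervals_empty)
  then show ?thesis by (simp add: forest_sum_def)
qed

text \<open>A forest becomes a tubing by adding the whole interval, if it is not there already.\<close>

lemma forest_sum_eq:
  assumes "a < b"
  shows "forest_sum x t a b = (x + t) * tubing_sum x t a b"
proof -
  let ?V = "{a..<b}" and ?T = "tubings {a..<b} (intervals a b)"
  let ?h = "\<lambda>M. x ^ (b - a - card M) * t ^ card M"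
  interpret graphical_family ?V "intervals a b" using graphical_family_intervals[OF assms] .
  have card: "1 \<le> card N" "card N \<le> b - a" if "N \<in> ?T" for N
    using card_tubing_bounds[OF that] by auto
  have fin: "finite (forests a b)"
    by (rule finite_subset[of _ "Pow (intervals a b)"]) (use finite_B in \<open>auto simp: forests_def nested_def\<close>)
  have "forests a b = ?T \<union> {M \<in> forests a b. ?V \<notin> M}" by (auto simp: forests_def tubings_def)
  then have "forest_sum x t a b = sum ?h ?T + sum ?h {M \<in> forests a b. ?V \<notin> M}"
    unfolding forest_sum_def using fin finite_tubings
    by (metis (no_types, lifting) sum.union_disjoint finite_Un disjoint_iff mem_Collect_eq tubings_def)
  also have "sum ?h ?T = t * tubing_sum x t a b"
    unfolding tubing_sum_def sum_distrib_left
  proof (intro sum.cong refl)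
    fix N assume "N \<in> ?T"
    then have "t ^ card N = t * t ^ (card N - 1)" using card(1) by (metis power_eq_if not_one_le_zero)
    then show "?h N = t * (x ^ (b - a - card N) * t ^ (card N - 1))" by (simp add: mult_ac)
  qed
  also have "sum ?h {M \<in> forests a b. ?V \<notin> M} = x * tubing_sum x t a b"
    unfolding tubing_sum_def sum_distrib_left
  proof (rule sum.reindex_bij_witness[where i = "\<lambda>N. N - {?V}" and j = "insert ?V"])
    fix N assume N: "N \<in> ?T"
    then show "insert ?V (N - {?V}) = N" by (auto simp: tubings_def)
    show "N - {?V} \<in> {M \<in> forests a b. ?V \<notin> M}"
      using N by (auto simp: forests_def tubings_def nested_def)
  next
    fix M assume M: "M \<in> {M \<in> forests a b. ?V \<notin> M}"
    then show "insert ?V M - {?V} = M" by auto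
    show T: "insert ?V M \<in> ?T" using insert_top_forest[of M a b] M assms by auto
    have c: "card (insert ?V M) = Suc (card M)" using M finite_forest by auto
    then have "x ^ (b - a - card M) = x * x ^ (b - a - Suc (card M))"
      using card(2)[OF T] by (metis Suc_diff_Suc Suc_le_lessD power_Suc)
    then show "x * (x ^ (b - a - card (insert ?V M)) * t ^ (card (insert ?V M) - 1)) = ?h M"
      using c by (simp add: mult_ac)
  qed
  finally show ?thesis by (simp add: algebra_simps)
qed

lemma full_forest_sum_eq:
  assumes "a \<le> b"
  shows "(\<Sum>M\<in>full_forests a b. x ^ (b - a - card M) * t ^ card M) =
    (if a = b then 1 else t * tubing_sum x t a b)"
proof (cases "a = b")
  case True
  have "full_forests b b = {{}}"
    by (auto simp: full_forests_def forests_def nested_def intervals_empty)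
  then show ?thesis using True by simp
next
  case False
  then have ab: "a < b" using assms by simp
  interpret graphical_family "{a..<b}" "intervals a b" using graphical_family_intervals[OF ab] .
  have "full_forests a b = tubings {a..<b} (intervals a b)"
    using ab by (auto simp: full_forests_def forests_def tubings_def)
  moreover have "t ^ card N = t * t ^ (card N - 1)" if "N \<in> tubings {a..<b} (intervals a b)" for N
    using card_tubing_bounds(1)[OF that] by (metis power_eq_if not_one_le_zero)
  ultimately show ?thesis using ab by (simp add: tubing_sum_def sum_distrib_left mult_ac)
qed

definition first_root :: "nat \<Rightarrow> nat \<Rightarrow> nat set set \<Rightarrow> nat" where
  "first_root a b N = Min ({a..<b} - \<Union>(N - {{a..<b}}))"

lemma first_root:
  assumes "a < b" "N \<in> tubings {a..<b} (intervals a b)"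
  shows "first_root a b N \<in> {a..<b} - \<Union>(N - {{a..<b}})"
    "a \<le> i \<Longrightarrow> i < first_root a b N \<Longrightarrow> i \<in> \<Union>(N - {{a..<b}})"
proof -
  let ?V = "{a..<b}" and ?R = "{a..<b} - \<Union>(N - {{a..<b}})"
  interpret graphical_family ?V "intervals a b" using graphical_family_intervals[OF assms(1)] .
  have NB: "N \<subseteq> intervals a b" using assms(2) by (auto simp: tubings_def nested_def)
  have "?R \<noteq> {}"
  proof
    assume "?R = {}"
    then obtain I where "I \<in> N - {?V}" "?V \<subseteq> I"
      using covered[OF V_in, of "N - {?V}"] assms(2) by (auto simp: tubings_def nested_def)
    then show False using B_subset NB by blast
  qed
  then show mem: "first_root a b N \<in> ?R" unfolding first_root_def by (intro Min_in) auto
  show "i \<in> \<Union>(N - {?V})" if "a \<le> i" "i < first_root a b N"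
  proof (rule ccontr)
    assume "i \<notin> \<Union>(N - {?V})"
    then have "i \<in> ?R" using that mem by auto
    then have "first_root a b N \<le> i" unfolding first_root_def by (intro Min_le) auto
    then show False using that by simp
  qed
qed

text \<open>
  Cut a tubing at the least element \<open>r\<close> that lies in no proper tube. Everything to the left of
  \<open>r\<close> is covered, so if it is nonempty it is itself a tube; to the right of \<open>r\<close> any nested
  family can occur.
\<close>

lemma tubing_sum_first_root:
  assumes r: "a \<le> r" "r < b"
  shows "(\<Sum>N | N \<in> tubings {a..<b} (intervals a b) \<and> first_root a b N = r.
            x ^ (b - a - card N) * t ^ (card N - 1)) =
         (\<Sum>M\<in>full_forests a r. x ^ (r - a - card M) * t ^ card M) * forest_sum x t (Suc r) b"
proof -
  let ?V = "{a..<b}" and ?T = "tubings {a..<b} (intervals a b)"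
  have ab: "a < b" using r by simp
  interpret graphical_family ?V "intervals a b" using graphical_family_intervals[OF ab] .
  let ?left = "\<lambda>N. {I \<in> N. I \<subseteq> {a..<r}}" and ?right = "\<lambda>N. {I \<in> N. I \<subseteq> {Suc r..<b}}"
  have subl: "intervals a r \<subseteq> intervals a b" and subr: "intervals (Suc r) b \<subseteq> intervals a b"
    using r intervals_mono[of a a r b] intervals_mono[of a "Suc r" b b] by auto
  have "(\<Sum>N | N \<in> ?T \<and> first_root a b N = r. x ^ (b - a - card N) * t ^ (card N - 1)) =
    (\<Sum>(L, R)\<in>full_forests a r \<times> forests (Suc r) b.
        (x ^ (r - a - card L) * t ^ card L) * (x ^ (b - Suc r - card R) * t ^ card R))"
  proof (rule sum.reindex_bij_witness[where j = "\<lambda>N. (?left N, ?right N)"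
        and i = "\<lambda>(L, R). insert ?V (L \<union> R)"])
    fix N assume "N \<in> {N. N \<in> ?T \<and> first_root a b N = r}"
    then have N: "N \<in> ?T" and fr: "first_root a b N = r" by auto
    have NB: "N \<subseteq> intervals a b" and VN: "?V \<in> N"
      and nest: "\<And>I J. I \<in> N \<Longrightarrow> J \<in> N \<Longrightarrow> I \<subseteq> J \<or> J \<subseteq> I \<or> I \<union> J \<notin> intervals a b"
      using N by (auto simp: tubings_def nested_def)
    have side: "(I \<in> intervals a r \<and> I \<subseteq> {a..<r} \<and> \<not> I \<subseteq> {Suc r..<b}) \<or>
        (I \<in> intervals (Suc r) b \<and> I \<subseteq> {Suc r..<b} \<and> \<not> I \<subseteq> {a..<r})"
      if I: "I \<in> N" "I \<noteq> ?V" for I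
    proof -
      obtain c d where cd: "I = {c..<d}" "a \<le> c" "c < d" "d \<le> b"
        using I NB by (meson intervalE subsetD)
      have "r \<notin> I" using first_root(1)[OF ab N] I fr by auto
      then have "d \<le> r \<or> Suc r \<le> c" using cd by auto
      then show ?thesis
      proof
        assume "d \<le> r"
        then have "c \<notin> {Suc r..<b}" "c \<in> I" "I \<in> intervals a r" using cd by (auto intro: intervalI)
        then show ?thesis using cd \<open>d \<le> r\<close> by fastforce
      next
        assume "Suc r \<le> c"
        then have "c \<notin> {a..<r}" "c \<in> I" "I \<in> intervals (Suc r) b" using cd by (auto intro: intervalI)
        then show ?thesis using cd \<open>Suc r \<le> c\<close> by fastforce
      qed
    qed
    have nsub: "\<not> ?V \<subseteq> {a..<r}" "\<not> ?V \<subseteq> {Suc r..<b}" using r by (auto simp: subset_iff)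
    show eq: "(case (?left N, ?right N) of (L, R) \<Rightarrow> insert ?V (L \<union> R)) = N"
      using side VN by auto
    have "{a..<r} \<in> N" if "a < r"
    proof -
      have "{a..<r} \<subseteq> \<Union>(N - {?V})" using first_root(2)[OF ab N] fr by auto
      moreover have "{a..<r} \<in> intervals a b" using that r by (intro intervalI) auto
      ultimately obtain I where I: "I \<in> N - {?V}" "{a..<r} \<subseteq> I"
        using covered[of "{a..<r}" "N - {?V}"] NB nest by auto
      then have "I \<subseteq> {a..<r}" using side[of I] that by fastforce
      then show ?thesis using I by auto
    qed
    moreover have "?left N \<in> forests a r"
      unfolding forests_def nested_def
    proof (intro CollectI conjI subsetI ballI)
      fix I assume I: "I \<in> ?left N"
      then have "I \<noteq> ?V" using nsub by blast
      then show "I \<in> intervals a r" using side[of I] I by blast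
    next
      fix I J assume "I \<in> ?left N" "J \<in> ?left N"
      then show "I \<subseteq> J \<or> J \<subseteq> I \<or> I \<union> J \<notin> intervals a r" using nest[of I J] subl by blast
    qed
    moreover have "?right N \<in> forests (Suc r) b"
      unfolding forests_def nested_def
    proof (intro CollectI conjI subsetI ballI)
      fix I assume I: "I \<in> ?right N"
      then have "I \<noteq> ?V" using nsub by blast
      then show "I \<in> intervals (Suc r) b" using side[of I] I by blast
    next
      fix I J assume "I \<in> ?right N" "J \<in> ?right N"
      then show "I \<subseteq> J \<or> J \<subseteq> I \<or> I \<union> J \<notin> intervals (Suc r) b" using nest[of I J] subr by blast
    qed
    ultimately show LR: "(?left N, ?right N) \<in> full_forests a r \<times> forests (Suc r) b"
      by (auto simp: full_forests_def)
    have fin: "finite N" using finite_forest[OF tubing_is_forest[OF N]] .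
    have "card N = Suc (card (?left N) + card (?right N))"
    proof -
      have "?left N \<inter> ?right N = {}"
      proof (intro equals0I)
        fix I assume I: "I \<in> ?left N \<inter> ?right N"
        then have "I \<noteq> {}" using NB B_nonempty by blast
        then show False using I by fastforce
      qed
      moreover have "?V \<notin> ?left N \<union> ?right N" using nsub by auto
      moreover have "N = insert ?V (?left N \<union> ?right N)" using eq by simp
      ultimately show ?thesis using fin by (metis (no_types, lifting) card_Un_disjoint card_insert_disjoint finite_Un finite_insert)
    qed
    moreover have "card (?left N) \<le> r - a" "card (?right N) \<le> b - Suc r"
      using LR card_forest_le by (auto simp: full_forests_def)
    ultimately have "b - a - card N = (r - a - card (?left N)) + (b - Suc r - card (?right N))"
      "card N - 1 = card (?left N) + card (?right N)" using r by auto
    then show "(case (?left N, ?right N) of (L, R) \<Rightarrow>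
        (x ^ (r - a - card L) * t ^ card L) * (x ^ (b - Suc r - card R) * t ^ card R)) =
      x ^ (b - a - card N) * t ^ (card N - 1)"
      by (simp add: power_add mult_ac)
  next
    fix p assume "p \<in> full_forests a r \<times> forests (Suc r) b"
    then obtain L R where p: "p = (L, R)" and L: "L \<in> forests a r" "a < r \<Longrightarrow> {a..<r} \<in> L"
      and R: "R \<in> forests (Suc r) b" by (auto simp: full_forests_def)
    let ?N = "insert ?V (L \<union> R)"
    have rV: "r \<in> ?V" using r by simp
    have Lout: "\<not> I \<subseteq> {Suc r..<b}" "r \<notin> I" "I \<subseteq> {a..<r}" "I \<noteq> {}" if "I \<in> L" for I
      using forestD[OF L(1) that] by fastforce+
    have Rout: "\<not> I \<subseteq> {a..<r}" "r \<notin> I" "I \<subseteq> {Suc r..<b}" "I \<noteq> {}" if "I \<in> R" for I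
      using forestD[OF R that] by fastforce+
    show "(?left (case p of (L, R) \<Rightarrow> insert ?V (L \<union> R)), ?right (case p of (L, R) \<Rightarrow> insert ?V (L \<union> R))) = p"
    proof -
      have nV: "\<not> ?V \<subseteq> {a..<r}" "\<not> ?V \<subseteq> {Suc r..<b}" using rV by auto
      have "?left ?N = L" using Lout(3) Rout(1) nV(1) by blast
      moreover have "?right ?N = R" using Lout(1) Rout(3) nV(2) by blast
      ultimately show ?thesis by (simp add: p)
    qed
    have mixed: "I \<union> J \<notin> intervals a b" if I: "I \<in> L" and J: "J \<in> R" for I J
    proof
      assume "I \<union> J \<in> intervals a b"
      then obtain c d where cd: "I \<union> J = {c..<d}" by (rule intervalE)
      obtain i j where ij: "i \<in> I" "j \<in> J" using Lout(4)[OF I] Rout(4)[OF J] by auto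
      then have "i < r" "r < j" using Lout(3)[OF I] Rout(3)[OF J] by auto
      moreover have "i \<in> {c..<d}" "j \<in> {c..<d}" using ij cd by blast+
      ultimately have "r \<in> {c..<d}" by simp
      then show False using cd Lout(2)[OF I] Rout(2)[OF J] by blast
    qed
    have local: "I \<union> J \<in> intervals l u" if IJ: "J \<subseteq> {l..<u}" "I \<subseteq> {l..<u}" "I \<union> J \<in> intervals a b" for I J l u
    proof -
      obtain c d where cd: "I \<union> J = {c..<d}" "c < d" using IJ(3) by (rule intervalE)
      have "{c..<d} \<subseteq> {l..<u}" using IJ(1,2) cd(1) by blast
      then show ?thesis using cd by (auto intro: intervalI)
    qed
    have "nested (intervals a b) ?N"
      unfolding nested_def
    proof (intro conjI ballI)
      show "?N \<subseteq> intervals a b" using forestD(3)[OF L(1)] forestD(3)[OF R] subl subr V_in by auto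
      fix I J assume I: "I \<in> ?N" and J: "J \<in> ?N"
      consider "I = ?V \<or> J = ?V" | "I \<in> L" "J \<in> L" | "I \<in> R" "J \<in> R" | "I \<in> L" "J \<in> R" | "I \<in> R" "J \<in> L"
        using I J by auto
      then show "I \<subseteq> J \<or> J \<subseteq> I \<or> I \<union> J \<notin> intervals a b"
      proof cases
        case 1
        then show ?thesis using I J \<open>?N \<subseteq> intervals a b\<close> B_subset by blast
      next
        case 2
        have "I \<subseteq> J \<or> J \<subseteq> I \<or> I \<union> J \<notin> intervals a r"
          using L(1) 2 by (simp add: forests_def nested_def)
        then show ?thesis using local[OF Lout(3)[OF 2(2)] Lout(3)[OF 2(1)]] by blast
      next
        case 3
        have "I \<subseteq> J \<or> J \<subseteq> I \<or> I \<union> J \<notin> intervals (Suc r) b"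
          using R 3 by (simp add: forests_def nested_def)
        then show ?thesis using local[OF Rout(3)[OF 3(2)] Rout(3)[OF 3(1)]] by blast
      next
        case 4
        then show ?thesis using mixed by blast
      next
        case 5
        then show ?thesis using mixed[of J I] by (simp add: Un_commute)
      qed
    qed
    then have N: "?N \<in> ?T" by (simp add: tubings_def)
    have "first_root a b ?N = r"
    proof -
      have proper: "?N - {?V} = L \<union> R" using Lout(2) Rout(2) rV by blast
      show ?thesis unfolding first_root_def proper
      proof (intro Min_eqI)
        show "r \<in> ?V - \<Union>(L \<union> R)" using rV Lout(2) Rout(2) by auto
        fix i assume i: "i \<in> ?V - \<Union>(L \<union> R)"
        show "r \<le> i"
        proof (rule ccontr)
          assume "\<not> r \<le> i"
          then have "i \<in> {a..<r}" "a < r" using i by auto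
          then show False using L(2) i by auto
        qed
      qed simp
    qed
    then show "(case p of (L, R) \<Rightarrow> insert ?V (L \<union> R)) \<in> {N. N \<in> ?T \<and> first_root a b N = r}"
      using N by (simp add: p)
  qed
  then show ?thesis
    by (simp add: forest_sum_def sum_product sum.cartesian_product)
qed

lemma tubing_sum_cut:
  assumes "a < b"
  shows "tubing_sum x t a b = (\<Sum>r\<in>{a..<b}.
    (if r = a then 1 else t * tubing_sum x t a r) *
    (if Suc r = b then 1 else (x + t) * tubing_sum x t (Suc r) b))"
proof -
  interpret graphical_family "{a..<b}" "intervals a b" using graphical_family_intervals[OF assms] .
  have "tubing_sum x t a b = (\<Sum>r\<in>{a..<b}.
    \<Sum>N | N \<in> tubings {a..<b} (intervals a b) \<and> first_root a b N = r.
      x ^ (b - a - card N) * t ^ (card N - 1))"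
    unfolding tubing_sum_def
    by (rule sum.group[symmetric]) (use finite_tubings first_root(1)[OF assms] in auto)
  also have "\<dots> = (\<Sum>r\<in>{a..<b}.
    (if r = a then 1 else t * tubing_sum x t a r) *
    (if Suc r = b then 1 else (x + t) * tubing_sum x t (Suc r) b))"
  proof (intro sum.cong refl)
    fix r assume "r \<in> {a..<b}"
    then have r: "a \<le> r" "r < b" by auto
    show "(\<Sum>N | N \<in> tubings {a..<b} (intervals a b) \<and> first_root a b N = r.
      x ^ (b - a - card N) * t ^ (card N - 1)) = (if r = a then 1 else t * tubing_sum x t a r) *
    (if Suc r = b then 1 else (x + t) * tubing_sum x t (Suc r) b)"
      unfolding tubing_sum_first_root[OF r] full_forest_sum_eq[OF r(1)]
      using r forest_sum_eq[of "Suc r" b x t] forest_sum_empty[of x t b] by auto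
  qed
  finally show ?thesis .
qed

text \<open>
  The cut formula determines the sums from those of shorter intervals, so by induction they depend
  on the length only.
\<close>

lemma tubing_sum_translate: "tubing_sum x t a (a + k) = tubing_sum x t 0 k"
proof (induction k arbitrary: a rule: less_induct)
  case (less k)
  define w where "w j = tubing_sum x t 0 j" for j
  have eq: "tubing_sum x t a (a + k) = (\<Sum>r<k. (if r = 0 then 1 else t * w r) *
      (if Suc r = k then 1 else (x + t) * w (k - Suc r)))" if k: "k > 0" for a
  proof -
    have "tubing_sum x t a (a + k) = (\<Sum>r\<in>{a..<a + k}. (if r = a then 1 else t * tubing_sum x t a r) *
      (if Suc r = a + k then 1 else (x + t) * tubing_sum x t (Suc r) (a + k)))"
      by (rule tubing_sum_cut) (use k in simp)
    also have "\<dots> = (\<Sum>r<k. (if r = 0 then 1 else t * tubing_sum x t a (a + r)) *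
      (if Suc r = k then 1 else (x + t) * tubing_sum x t (Suc (a + r)) (a + k)))"
      by (rule sum.reindex_bij_witness[where i = "\<lambda>r. a + r" and j = "\<lambda>r. r - a"]) auto
    also have "\<dots> = (\<Sum>r<k. (if r = 0 then 1 else t * w r) *
      (if Suc r = k then 1 else (x + t) * w (k - Suc r)))"
    proof (intro sum.cong refl)
      fix r assume "r \<in> {..<k}"
      then have "tubing_sum x t a (a + r) = w r"
        "tubing_sum x t (Suc (a + r)) (a + k) = w (k - Suc r)"
        using less.IH[of r a] less.IH[of "k - Suc r" "Suc (a + r)"] by (auto simp: w_def)
      then show "(if r = 0 then 1 else t * tubing_sum x t a (a + r)) *
        (if Suc r = k then 1 else (x + t) * tubing_sum x t (Suc (a + r)) (a + k)) =
        (if r = 0 then 1 else t * w r) * (if Suc r = k then 1 else (x + t) * w (k - Suc r))"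
        by simp
    qed
    finally show ?thesis .
  qed
  show ?case
  proof (cases "k = 0")
    case False
    then show ?thesis using eq[of a] eq[of 0] by simp
  next
    case True
    then show ?thesis by (simp add: tubing_sum_def tubings_def nested_def intervals_empty)
  qed
qed

lemma tubing_sum_recursion:
  fixes x t :: "'a::comm_ring_1"
  defines "w \<equiv> tubing_sum x t 0"
  shows "w (Suc 0) = 1"
    and "n \<ge> 1 \<Longrightarrow> w (Suc n) = (x + 2 * t) * w n + (x + t) * t * (\<Sum>i = 1..n - 1. w i * w (n - i))"
proof -
  have cut: "w (Suc n) = (\<Sum>r<Suc n. (if r = 0 then 1 else t * w r) *
      (if r = n then 1 else (x + t) * w (n - r)))" for n
  proof -
    have "tubing_sum x t (Suc r) (Suc n) = w (n - r)" if "r \<le> n" for r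
      using tubing_sum_translate[of x t "Suc r" "n - r"] that by (simp add: w_def)
    then show ?thesis
      unfolding w_def by (subst tubing_sum_cut) (auto simp: atLeast0LessThan intro!: sum.cong)
  qed
  show "w (Suc 0) = 1" using cut[of 0] by simp
  assume n: "n \<ge> 1"
  define f where "f r = (if r = 0 then 1 else t * w r) * (if r = n then 1 else (x + t) * w (n - r))" for r
  have "w (Suc n) = f 0 + f n + (\<Sum>r = 1..n - 1. f r)"
  proof -
    have "{..<Suc n} = insert 0 (insert n {1..n - 1})" using n by auto
    then show ?thesis using n cut[of n] by (simp add: f_def add_ac)
  qed
  also have "(\<Sum>r = 1..n - 1. f r) = (x + t) * t * (\<Sum>i = 1..n - 1. w i * w (n - i))"
    unfolding sum_distrib_left using n by (intro sum.cong) (auto simp: f_def mult_ac)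
  finally show "w (Suc n) = (x + 2 * t) * w n + (x + t) * t * (\<Sum>i = 1..n - 1. w i * w (n - i))"
    using n by (simp add: f_def algebra_simps)
qed

lemma H_expr_associahedron:
  fixes a t :: "'a::comm_ring_1"
  shows "H_expr (associahedron n) a t = tubing_sum (a - t) t 0 (Suc n)"
  using tubing_sum_translate[of "a - t" t 1 "Suc n"]
  by (simp add: H_expr_def F_expr_associahedron)

lemma H_poly_associahedron_0: "H_poly (associahedron 0) = 1"
  by (simp add: H_poly_def H_expr_associahedron tubing_sum_recursion(1))

lemma H_poly_associahedron:
  assumes "n \<ge> 1"
  shows "H_poly (associahedron n) = (var_alpha + var_t) * H_poly (associahedron (n - 1)) +
    var_alpha * var_t * (\<Sum>i = 1..n - 1. H_poly (associahedron (i - 1)) * H_poly (associahedron (n - i - 1)))"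
proof -
  have "(\<Sum>i = 1..n - 1. H_poly (associahedron (i - 1)) * H_poly (associahedron (n - i - 1))) =
    (\<Sum>i = 1..n - 1. tubing_sum (var_alpha - var_t) var_t 0 i * tubing_sum (var_alpha - var_t) var_t 0 (n - i))"
    by (intro sum.cong refl) (auto simp: H_poly_def H_expr_associahedron Suc_diff_Suc simp flip: Suc_diff_le)
  moreover have "H_poly (associahedron (n - 1)) = tubing_sum (var_alpha - var_t) var_t 0 n"
    using assms by (simp add: H_poly_def H_expr_associahedron)
  ultimately show ?thesis
    using tubing_sum_recursion(2)[OF assms, of "var_alpha - var_t" var_t]
    by (simp add: H_poly_def H_expr_associahedron algebra_simps)
qed

section \<open>Gamma polynomials\<close>

definition gamma_expand :: "nat \<Rightarrow> int poly \<Rightarrow> 'a::comm_ring_1 \<Rightarrow> 'a \<Rightarrow> 'a" where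
  "gamma_expand d g u v = (\<Sum>i\<le>d div 2. of_int (coeff g i) * u ^ i * v ^ (d - 2 * i))"

lemma gamma_expand_add:
  "gamma_expand d (g + h) u v = gamma_expand d g u v + gamma_expand d h u v"
  by (simp add: gamma_expand_def sum.distrib algebra_simps)

lemma gamma_expand_0: "gamma_expand d 0 u v = 0"
  by (simp add: gamma_expand_def)

lemma gamma_expand_sum:
  "gamma_expand d (\<Sum>i\<in>A. g i) u v = (\<Sum>i\<in>A. gamma_expand d (g i) u v)"
  by (induction A rule: infinite_finite_induct) (auto simp: gamma_expand_0 gamma_expand_add)

lemma gamma_expand_monom:
  assumes "2 * k \<le> d"
  shows "gamma_expand d (monom c k) u v = of_int c * u ^ k * v ^ (d - 2 * k)"
proof -
  have "gamma_expand d (monom c k) u v =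
      (\<Sum>i\<le>d div 2. if i = k then of_int c * u ^ k * v ^ (d - 2 * k) else 0)"
    unfolding gamma_expand_def by (intro sum.cong) auto
  then show ?thesis using assms by simp
qed

text \<open>The degree bounds keep all exponents of \<open>v\<close> free of truncated subtraction.\<close>

lemma gamma_expand_mult:
  assumes g: "degree g \<le> d div 2" and h: "degree h \<le> e div 2"
  shows "gamma_expand (d + e) (g * h) u v = gamma_expand d g u v * gamma_expand e h u v"
proof -
  have gh: "g * h = (\<Sum>i\<le>d div 2. \<Sum>j\<le>e div 2. monom (coeff g i * coeff h j) (i + j))"
    unfolding mult_monom[symmetric] sum_product[symmetric]
    by (simp only: poly_as_sum_of_monoms'[OF g] poly_as_sum_of_monoms'[OF h])
  have "gamma_expand (d + e) (g * h) u v = (\<Sum>i\<le>d div 2. \<Sum>j\<le>e div 2.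
      (of_int (coeff g i) * u ^ i * v ^ (d - 2 * i)) * (of_int (coeff h j) * u ^ j * v ^ (e - 2 * j)))"
    unfolding gh gamma_expand_sum
  proof (intro sum.cong refl)
    fix i j assume "i \<in> {..d div 2}" "j \<in> {..e div 2}"
    then have ij: "2 * i \<le> d" "2 * j \<le> e" by auto
    then have le: "2 * (i + j) \<le> d + e" and "d + e - 2 * (i + j) = (d - 2 * i) + (e - 2 * j)" by auto
    then have v: "v ^ (d + e - 2 * (i + j)) = v ^ (d - 2 * i) * v ^ (e - 2 * j)" by (simp only: power_add)
    then show "gamma_expand (d + e) (monom (coeff g i * coeff h j) (i + j)) u v =
      (of_int (coeff g i) * u ^ i * v ^ (d - 2 * i)) * (of_int (coeff h j) * u ^ j * v ^ (e - 2 * j))"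
      unfolding gamma_expand_monom[OF le] v by (simp add: power_add mult_ac)
  qed
  also have "\<dots> = gamma_expand d g u v * gamma_expand e h u v"
    by (simp add: gamma_expand_def sum_product)
  finally show ?thesis .
qed

text \<open>
  Substituting \<open>1 - t\<close> for \<open>\<alpha>\<close> turns \<open>\<alpha> + t\<close> into \<open>1\<close> and \<open>\<alpha> t\<close> into the nonconstant polynomial
  \<open>t - t\<^sup>2\<close>, so the expansion becomes \<open>g\<close> composed with it, from which \<open>g\<close> can be recovered.
\<close>

lemma gamma_expand_inject:
  assumes g: "degree g \<le> d div 2" and h: "degree h \<le> d div 2"
    and eq: "gamma_expand d g (var_alpha * var_t) (var_alpha + var_t) =
             gamma_expand d h (var_alpha * var_t) (var_alpha + var_t)"
  shows "g = h"
proof -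
  let ?q = "[:0, 1, -1:] :: int poly"
  have power: "pcompose (p ^ i) ?q = pcompose p ?q ^ i" for p i
    by (induction i) (simp_all add: pcompose_mult pcompose_1)
  have subst: "poly (gamma_expand d p (var_alpha * var_t) (var_alpha + var_t)) [:1, -1:] = pcompose p ?q"
    if p: "degree p \<le> d div 2" for p
  proof -
    have 1: "poly var_alpha [:1, -1:] * poly var_t [:1, -1:] = ?q"
      and 2: "poly var_alpha [:1, -1:] + poly var_t [:1, -1:] = 1"
      by (simp_all add: var_alpha_def var_t_def one_pCons)
    have "poly (gamma_expand d p (var_alpha * var_t) (var_alpha + var_t)) [:1, -1:] =
        (\<Sum>i\<le>d div 2. of_int (coeff p i) * ?q ^ i)"
      by (simp add: gamma_expand_def poly_sum 1 2 del: poly_pCons)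
    also have "\<dots> = (\<Sum>i\<le>d div 2. pcompose (monom (coeff p i) i) ?q)"
      by (intro sum.cong refl) (simp add: monom_altdef pcompose_smult power pcompose_pCons of_int_poly)
    also have "\<dots> = pcompose p ?q"
      by (simp only: pcompose_sum[symmetric] poly_as_sum_of_monoms'[OF p])
    finally show ?thesis .
  qed
  have "pcompose (g - h) ?q = 0"
    using subst[OF g] subst[OF h] eq by (simp add: pcompose_diff)
  then have "g - h = 0" by (rule pcompose_eq_0) simp
  then show ?thesis by simp
qed

definition is_gamma :: "nat \<Rightarrow> int poly \<Rightarrow> bool" where
  "is_gamma n g \<longleftrightarrow> degree g \<le> n div 2 \<and>
     H_poly (associahedron n) = gamma_expand n g (var_alpha * var_t) (var_alpha + var_t)"

lemma gamma_poly_eqI: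
  assumes "is_gamma n g"
  shows "gamma_poly (associahedron n) = g"
  using assms gamma_expand_inject unfolding gamma_poly_def affdim_associahedron is_gamma_def gamma_expand_def
  by (intro the_equality) auto

text \<open>
  The factors \<open>\<alpha> + t\<close> and \<open>\<alpha> t\<close> of the recursion for \<open>H\<close> are the expansions of \<open>1\<close> in degree one
  and of \<open>\<tau>\<close> in degree two, so each term is the expansion of a product.
\<close>

lemma is_gamma_step:
  assumes n: "n \<ge> 1" and G: "\<And>k. k < n \<Longrightarrow> is_gamma k (G k)"
  shows "is_gamma n (G (n - 1) + [:0, 1:] * (\<Sum>i = 1..n - 1. G (i - 1) * G (n - i - 1)))"
proof -
  let ?u = "var_alpha * var_t" and ?v = "var_alpha + var_t"
  have deg: "degree (G k) \<le> k div 2" and H: "H_poly (associahedron k) = gamma_expand k (G k) ?u ?v"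
    if "k < n" for k using G[OF that] by (auto simp: is_gamma_def)
  have one: "gamma_expand (Suc 0) 1 u v = v" for u v :: "int poly poly"
    by (simp add: gamma_expand_def)
  have two: "gamma_expand 2 [:0, 1:] u v = u" for u v :: "int poly poly"
    by (simp add: gamma_expand_def)
  have lin: "gamma_expand n (G (n - 1)) ?u ?v = ?v * H_poly (associahedron (n - 1))"
    using gamma_expand_mult[of 1 1 "G (n - 1)" "n - 1" ?u ?v] n deg[of "n - 1"] H[of "n - 1"]
    by (simp add: one)
  have quad: "gamma_expand n ([:0, 1:] * (G (i - 1) * G (n - i - 1))) ?u ?v =
      ?u * (H_poly (associahedron (i - 1)) * H_poly (associahedron (n - i - 1)))"
    and quad_deg: "degree ([:0, 1:] * (G (i - 1) * G (n - i - 1))) \<le> n div 2"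
    if i: "i \<in> {1..n - 1}" for i
  proof -
    have lt: "i - 1 < n" "n - i - 1 < n" and n_eq: "n = 2 + ((i - 1) + (n - i - 1))" using i by auto
    have "degree (G (i - 1) * G (n - i - 1)) \<le> (i - 1) div 2 + (n - i - 1) div 2"
      using degree_mult_le deg[OF lt(1)] deg[OF lt(2)] by (meson add_mono order_trans)
    also have "\<dots> \<le> ((i - 1) + (n - i - 1)) div 2" by linarith
    finally have d: "degree (G (i - 1) * G (n - i - 1)) \<le> ((i - 1) + (n - i - 1)) div 2" .
    show "gamma_expand n ([:0, 1:] * (G (i - 1) * G (n - i - 1))) ?u ?v =
      ?u * (H_poly (associahedron (i - 1)) * H_poly (associahedron (n - i - 1)))"
      unfolding H[OF lt(1)] H[OF lt(2)]
      using gamma_expand_mult[of "[:0, 1:]" 2 _ _ ?u ?v, OF _ d] n_eq two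
        gamma_expand_mult[OF deg[OF lt(1)] deg[OF lt(2)], of ?u ?v] by simp
    have "degree ([:0, 1:] * (G (i - 1) * G (n - i - 1))) \<le> 1 + ((i - 1) + (n - i - 1)) div 2"
      using degree_mult_le[of "[:0, 1:]" "G (i - 1) * G (n - i - 1)"] d by simp
    also have "\<dots> = n div 2"
    proof -
      have "(i - 1) + (n - i - 1) = n - 2" "2 \<le> n" using i by auto
      then show ?thesis by presburger
    qed
    finally show "degree ([:0, 1:] * (G (i - 1) * G (n - i - 1))) \<le> n div 2" .
  qed
  have "degree (G (n - 1)) \<le> n div 2" using deg[of "n - 1"] n by linarith
  moreover have "degree ([:0, 1:] * (\<Sum>i = 1..n - 1. G (i - 1) * G (n - i - 1))) \<le> n div 2"
    unfolding sum_distrib_left by (intro degree_sum_le quad_deg) auto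
  moreover have "gamma_expand n ([:0, 1:] * (\<Sum>i = 1..n - 1. G (i - 1) * G (n - i - 1))) ?u ?v =
      ?u * (\<Sum>i = 1..n - 1. H_poly (associahedron (i - 1)) * H_poly (associahedron (n - i - 1)))"
    unfolding sum_distrib_left gamma_expand_sum by (intro sum.cong refl quad)
  ultimately show ?thesis
    unfolding is_gamma_def gamma_expand_add lin H_poly_associahedron[OF n]
    by (auto intro: degree_add_le)
qed

lemma is_gamma_gamma_poly: "is_gamma n (gamma_poly (associahedron n))"
proof (induction n rule: less_induct)
  case (less n)
  have "\<exists>g. is_gamma n g"
  proof (cases "n = 0")
    case True
    have "is_gamma 0 1" by (simp add: is_gamma_def gamma_expand_def H_poly_associahedron_0)
    then show ?thesis using True by blast
  next
    case False
    then show ?thesis using is_gamma_step[of n "\<lambda>k. gamma_poly (associahedron k)"] less by auto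
  qed
  then show ?case using gamma_poly_eqI by metis
qed

theorem mainTheorem6:
  fixes n :: nat
  assumes "n \<ge> 1"
  shows "gamma_poly (associahedron n) =
           gamma_poly (associahedron (n - 1)) +
           [:0, 1:] * (\<Sum>i = 1..n - 1. gamma_poly (associahedron (i - 1)) *
                                        gamma_poly (associahedron (n - i - 1)))
       \<and> H_poly (associahedron n) =
           (var_alpha + var_t) * H_poly (associahedron (n - 1)) +
           var_alpha * var_t * (\<Sum>i = 1..n - 1. H_poly (associahedron (i - 1)) *
                                                H_poly (associahedron (n - i - 1)))"
proof
  show "gamma_poly (associahedron n) = gamma_poly (associahedron (n - 1)) +
      [:0, 1:] * (\<Sum>i = 1..n - 1. gamma_poly (associahedron (i - 1)) * gamma_poly (associahedron (n - i - 1)))"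
    using is_gamma_step[OF assms, of "\<lambda>k. gamma_poly (associahedron k)"] is_gamma_gamma_poly
    by (intro gamma_poly_eqI) simp
qed (rule H_poly_associahedron[OF assms])

end
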